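(* Let $G$ be an infinite, connected, bipartite graph with vertex classes coloured black and white, such that the coloured graph is quasi-transitive and every vertex has degree $3$. Let $\phi_1,\phi_2$ be local transformations, and let $\widetilde G$ be obtained from $G$ by applying $\phi_1$ at each black vertex and $\phi_2$ at each white vertex (assumed connected). Then the connective constants $\mu=\mu(G)$ and $\widetilde\mu=\mu(\widetilde G)$ satisfy \[ \mu^{-2}=g_{\phi_1}(\widetilde\mu^{-1})\,g_{\phi_2}(\widetilde\mu^{-1}). \]
   Context: All graphs are simple. For a bipartite graph with a colouring $\chi$ of its two classes, the coloured-automorphism group consists of graph automorphisms preserving colours; the coloured graph is quasi-transitive if there is a finite $W\subseteq V$ such that for every vertex $v$ some coloured automorphism $\alpha$ has $\alpha v\in W$. The connective constant of a quasi-transitive graph is $\mu=\lim_n\sigma_n(v)^{1/n}$, $\sigma_n(v)$ the number of $n$-step self-avoiding walks from $v$. Local transformation: a local transformation $\phi$ acts at a degree-$3$ vertex $v$ of a simple graph by replacing $v$ with a finite connected graph (the gadget) $\phi(v)$ having three distinct distinguished outer vertices (ports) $w_1,w_2,w_3$, each port being attached to exactly one of the three edges formerly incident to $v$ (one port per edge). It is required that (i) all gadgets $\phi(v)$ are isomorphic via isomorphisms sending ports to ports, and (ii) some subgroup of the automorphism group of $\phi(v)$ preserves the set $\{w_1,w_2,w_3\}$ and acts transitively on it. Mid-edge convention: each edge $e$ is identified with a point at its middle. Walks may start and end at mid-edges; such a walk is self-avoiding (a SAW) if it visits no vertex and no mid-edge more than once, and its length $|\pi|$ is the number of vertices it visits.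 Gadget series: for a degree-$3$ vertex $v$ with incident edges $e_1,e_2,e_3$, $g(x)=g_\phi(x)=\sum_{\pi}x^{|\pi|}$, where the sum is over all SAWs $\pi$ that start at the mid-edge of $e_1$, end at the mid-edge of $e_2$, and otherwise visit only vertices of the gadget $\phi(v)$. This polynomial does not depend on $v$ nor on the chosen pair of incident edges. *)

theory Defs
  imports Complex_Main
begin

definition simple_graph :: "'v set \<Rightarrow> ('v \<Rightarrow> 'v \<Rightarrow> bool) \<Rightarrow> bool" where
  "simple_graph V E \<longleftrightarrow>
     (\<forall>x y. E x y \<longrightarrow> x \<in> V \<and> y \<in> V) \<and>
     (\<forall>x y. E x y \<longrightarrow> E y x) \<and> (\<forall>x. \<not> E x x)"

definition connected_graph :: "'v set \<Rightarrow> ('v \<Rightarrow> 'v \<Rightarrow> bool) \<Rightarrow> bool" where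
  "connected_graph V E \<longleftrightarrow> (\<forall>x\<in>V. \<forall>y\<in>V. E\<^sup>*\<^sup>* x y)"

definition degree :: "('v \<Rightarrow> 'v \<Rightarrow> bool) \<Rightarrow> 'v \<Rightarrow> nat" where
  "degree E v = card {u. E v u}"

text \<open>Bipartite graph whose two classes are coloured: col v = True means black.\<close>
definition proper_bicolouring :: "('v \<Rightarrow> 'v \<Rightarrow> bool) \<Rightarrow> ('v \<Rightarrow> bool) \<Rightarrow> bool" where
  "proper_bicolouring E col \<longleftrightarrow> (\<forall>x y. E x y \<longrightarrow> col x \<noteq> col y)"

definition graph_aut :: "'v set \<Rightarrow> ('v \<Rightarrow> 'v \<Rightarrow> bool) \<Rightarrow> ('v \<Rightarrow> 'v) \<Rightarrow> bool" where
  "graph_aut V E \<alpha> \<longleftrightarrow> bij_betw \<alpha> V V \<and> (\<forall>x\<in>V. \<forall>y\<in>V. E x y \<longleftrightarrow> E (\<alpha> x) (\<alpha> y))"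

definition coloured_aut ::
  "'v set \<Rightarrow> ('v \<Rightarrow> 'v \<Rightarrow> bool) \<Rightarrow> ('v \<Rightarrow> bool) \<Rightarrow> ('v \<Rightarrow> 'v) \<Rightarrow> bool" where
  "coloured_aut V E col \<alpha> \<longleftrightarrow> graph_aut V E \<alpha> \<and> (\<forall>x\<in>V. col (\<alpha> x) = col x)"

definition coloured_quasi_transitive ::
  "'v set \<Rightarrow> ('v \<Rightarrow> 'v \<Rightarrow> bool) \<Rightarrow> ('v \<Rightarrow> bool) \<Rightarrow> bool" where
  "coloured_quasi_transitive V E col \<longleftrightarrow>
     (\<exists>W. finite W \<and> W \<subseteq> V \<and> (\<forall>v\<in>V. \<exists>\<alpha>. coloured_aut V E col \<alpha> \<and> \<alpha> v \<in> W))"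

definition is_walk :: "('v \<Rightarrow> 'v \<Rightarrow> bool) \<Rightarrow> 'v list \<Rightarrow> bool" where
  "is_walk E xs \<longleftrightarrow> (\<forall>i. Suc i < length xs \<longrightarrow> E (xs ! i) (xs ! Suc i))"

definition saws_from :: "('v \<Rightarrow> 'v \<Rightarrow> bool) \<Rightarrow> 'v \<Rightarrow> nat \<Rightarrow> 'v list set" where
  "saws_from E v n = {xs. length xs = Suc n \<and> hd xs = v \<and> distinct xs \<and> is_walk E xs}"

definition saw_count :: "('v \<Rightarrow> 'v \<Rightarrow> bool) \<Rightarrow> 'v \<Rightarrow> nat \<Rightarrow> nat" where
  "saw_count E v n = card (saws_from E v n)"

definition connective_constant :: "('v \<Rightarrow> 'v \<Rightarrow> bool) \<Rightarrow> 'v \<Rightarrow> real" where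
  "connective_constant E v = lim (\<lambda>n. root n (real (saw_count E v n)))"

definition port_symmetric :: "'a set \<Rightarrow> ('a \<Rightarrow> 'a \<Rightarrow> bool) \<Rightarrow> 'a set \<Rightarrow> bool" where
  "port_symmetric V E P \<longleftrightarrow>
     (\<exists>S. (\<forall>\<alpha>\<in>S. graph_aut V E \<alpha> \<and> \<alpha> ` P = P) \<and>
          (\<forall>\<alpha>\<in>S. \<forall>\<beta>\<in>S. \<alpha> \<circ> \<beta> \<in> S) \<and>
          (\<forall>\<alpha>\<in>S. \<exists>\<beta>\<in>S. \<forall>x\<in>V. \<beta> (\<alpha> x) = x) \<and>
          (\<forall>p\<in>P. \<forall>q\<in>P. \<exists>\<alpha>\<in>S. \<alpha> p = q))"

definition local_transformation :: "'a set \<Rightarrow> ('a \<Rightarrow> 'a \<Rightarrow> bool) \<Rightarrow> 'a \<Rightarrow> 'a \<Rightarrow> 'a \<Rightarrow> bool" where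
  "local_transformation V E w1 w2 w3 \<longleftrightarrow>
     simple_graph V E \<and> finite V \<and> connected_graph V E \<and>
     w1 \<in> V \<and> w2 \<in> V \<and> w3 \<in> V \<and> w1 \<noteq> w2 \<and> w1 \<noteq> w3 \<and> w2 \<noteq> w3 \<and>
     port_symmetric V E {w1, w2, w3}"

text \<open>Gadget series g(x): sum over SAWs from the mid-edge of e1 (attached to port w1) to the
  mid-edge of e2 (attached to port w2) staying inside the gadget, i.e. over vertex-self-avoiding
  paths in the gadget from w1 to w2, weighted by x^(number of vertices visited).\<close>
definition gadget_paths :: "'a set \<Rightarrow> ('a \<Rightarrow> 'a \<Rightarrow> bool) \<Rightarrow> 'a \<Rightarrow> 'a \<Rightarrow> 'a list set" where
  "gadget_paths V E p q =
     {xs. xs \<noteq> [] \<and> hd xs = p \<and> last xs = q \<and> set xs \<subseteq> V \<and> distinct xs \<and> is_walk E xs}"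

definition gadget_series :: "'a set \<Rightarrow> ('a \<Rightarrow> 'a \<Rightarrow> bool) \<Rightarrow> 'a \<Rightarrow> 'a \<Rightarrow> real \<Rightarrow> real" where
  "gadget_series V E p q x = (\<Sum>xs\<in>gadget_paths V E p q. x ^ length xs)"

text \<open>The transformed graph: black vertex v is replaced by a copy of gadget 1 (vertices
  (v, Inl a)), white vertex v by a copy of gadget 2 (vertices (v, Inr b)).  For an edge vu
  of G, port1 v u (resp. port2 v u) is the port of the gadget at v attached to the edge vu.\<close>
definition tr_vertices :: "'v set \<Rightarrow> ('v \<Rightarrow> bool) \<Rightarrow> 'a set \<Rightarrow> 'b set \<Rightarrow> ('v \<times> ('a + 'b)) set" where
  "tr_vertices V col V1 V2 =
     {(v, Inl a) | v a. v \<in> V \<and> col v \<and> a \<in> V1} \<union> {(v, Inr b) | v b. v \<in> V \<and> \<not> col v \<and> b \<in> V2}"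

fun sum_edge :: "('a \<Rightarrow> 'a \<Rightarrow> bool) \<Rightarrow> ('b \<Rightarrow> 'b \<Rightarrow> bool) \<Rightarrow> 'a + 'b \<Rightarrow> 'a + 'b \<Rightarrow> bool" where
  "sum_edge E1 E2 (Inl a) (Inl a') = E1 a a'"
| "sum_edge E1 E2 (Inr b) (Inr b') = E2 b b'"
| "sum_edge E1 E2 _ _ = False"

definition tr_port :: "('v \<Rightarrow> bool) \<Rightarrow> ('v \<Rightarrow> 'v \<Rightarrow> 'a) \<Rightarrow> ('v \<Rightarrow> 'v \<Rightarrow> 'b) \<Rightarrow> 'v \<Rightarrow> 'v \<Rightarrow> 'a + 'b" where
  "tr_port col port1 port2 v u = (if col v then Inl (port1 v u) else Inr (port2 v u))"

definition tr_edges ::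
  "'v set \<Rightarrow> ('v \<Rightarrow> 'v \<Rightarrow> bool) \<Rightarrow> ('v \<Rightarrow> bool) \<Rightarrow> 'a set \<Rightarrow> ('a \<Rightarrow> 'a \<Rightarrow> bool) \<Rightarrow>
   'b set \<Rightarrow> ('b \<Rightarrow> 'b \<Rightarrow> bool) \<Rightarrow> ('v \<Rightarrow> 'v \<Rightarrow> 'a) \<Rightarrow> ('v \<Rightarrow> 'v \<Rightarrow> 'b) \<Rightarrow>
   'v \<times> ('a + 'b) \<Rightarrow> 'v \<times> ('a + 'b) \<Rightarrow> bool" where
  "tr_edges V E col V1 E1 V2 E2 port1 port2 p q \<longleftrightarrow>
     p \<in> tr_vertices V col V1 V2 \<and> q \<in> tr_vertices V col V1 V2 \<and>
     ((fst p = fst q \<and> sum_edge E1 E2 (snd p) (snd q)) \<or>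
      (E (fst p) (fst q) \<and> snd p = tr_port col port1 port2 (fst p) (fst q) \<and>
                           snd q = tr_port col port1 port2 (fst q) (fst p)))"

definition valid_ports ::
  "'v set \<Rightarrow> ('v \<Rightarrow> 'v \<Rightarrow> bool) \<Rightarrow> ('v \<Rightarrow> bool) \<Rightarrow> 'a set \<Rightarrow> 'b set \<Rightarrow>
   ('v \<Rightarrow> 'v \<Rightarrow> 'a) \<Rightarrow> ('v \<Rightarrow> 'v \<Rightarrow> 'b) \<Rightarrow> bool" where
  "valid_ports V E col P1 P2 port1 port2 \<longleftrightarrow>
     (\<forall>v\<in>V. col v \<longrightarrow> bij_betw (port1 v) {u. E v u} P1) \<and>
     (\<forall>v\<in>V. \<not> col v \<longrightarrow> bij_betw (port2 v) {u. E v u} P2)"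

end

theory Submission
  imports Defs
begin

text \<open>
  A self-avoiding walk in the transformed graph crosses every gadget other than its first and last
  one at most once, since two crossings would need four ports. Up to bounded end pieces it is
  therefore a self-avoiding walk of the original graph together with a port-to-port path in each
  gadget visited. As the colours alternate along a walk, the total weight of the lifts of a walk
  with \<open>n\<close> steps is, up to constants, \<open>y\<^sup>n\<close> with \<open>y\<^sup>2 = g\<^sub>1(x) g\<^sub>2(x)\<close>, and comparing generating functions
  gives the critical point \<open>x\<^sub>0\<close> as the solution of \<open>g\<^sub>1(x) g\<^sub>2(x) = \<mu>\<^sup>-\<^sup>2\<close>.

  The transformed graph need not be quasi-transitive, because the ports may be attached
  differently at each vertex, so the existence of the limit that defines its connective constant
  has to be proved directly. Submultiplicativity with respect to uniform upper bounds spreads a lower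
  bound at a single length \<open>K \<in> [n, L(n+1)]\<close> to the length \<open>n\<close>, and such a \<open>K\<close> exists by averaging.
\<close>

section \<open>Exponential growth rates\<close>

text \<open>Both connective constants are reached through bounds \<open>C * \<rho> ^ n\<close> with
  \<rho> strictly on one side of the limit. Constants, and factors polynomial in \<open>n\<close>,
  are then absorbed by a slight change of base, so an average over linearly many lengths costs
  nothing.

  The spreading principle is used twice. In the transformed graph the candidate lengths are those of
  lifts. In the original graph it makes the growth rate independent of the starting vertex: a walk
  from the best vertex of a finite set is cut where it meets a path coming from the given vertex,
  and the longer of the two resulting walks supplies \<open>K\<close>.

  The end gadgets shape the notion of a route. A walk that starts inside a gadget may use one port
  to leave it, return through a second and leave by the third; likewise the last gadget may have
  been crossed before. Hence only the inner part of a route is self-avoiding, while at the ends just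
  backtracking is excluded. This still makes each crossing join two different ports and contribute
  one factor of the gadget series.\<close>

lemma root_tendsto_of_geometric_bounds:
  fixes s :: "nat \<Rightarrow> real"
  assumes \<mu>: "\<mu> > 0"
    and upper: "\<And>\<rho>. \<mu> < \<rho> \<Longrightarrow> \<exists>C>0. \<forall>n. s n \<le> C * \<rho> ^ n"
    and lower: "\<And>\<rho>. 0 < \<rho> \<Longrightarrow> \<rho> < \<mu> \<Longrightarrow> \<exists>c>0. \<forall>n. c * \<rho> ^ n \<le> s n"
  shows "(\<lambda>n. root n (s n)) \<longlonglongrightarrow> \<mu>"
proof (rule order_tendstoI)
  fix a assume "a < \<mu>"
  define \<rho> where "\<rho> = (max a 0 + \<mu>) / 2"
  have \<rho>: "0 < \<rho>" "\<rho> < \<mu>" "a < \<rho>" using \<open>a < \<mu>\<close> \<mu> by (auto simp: \<rho>_def)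
  obtain c where c: "c > 0" "\<And>n. c * \<rho> ^ n \<le> s n" using lower[OF \<rho>(1,2)] by blast
  have "(\<lambda>n. root n c * \<rho>) \<longlonglongrightarrow> 1 * \<rho>"
    by (intro tendsto_intros LIMSEQ_root_const c)
  hence "\<forall>\<^sub>F n in sequentially. a < root n c * \<rho>"
    using \<rho> by (auto dest: order_tendstoD)
  thus "\<forall>\<^sub>F n in sequentially. a < root n (s n)"
    using eventually_gt_at_top[of 0]
  proof eventually_elim
    case (elim n)
    have "root n c * \<rho> = root n (c * \<rho> ^ n)"
      using \<rho> elim by (simp add: real_root_mult real_root_power_cancel)
    also have "\<dots> \<le> root n (s n)" using c(2)[of n] elim by simp
    finally show ?case using elim by simp
  qed
next
  fix a assume "\<mu> < a"
  define \<rho> where "\<rho> = (a + \<mu>) / 2"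
  have \<rho>: "0 < \<rho>" "\<mu> < \<rho>" "\<rho> < a" using \<open>\<mu> < a\<close> \<mu> by (auto simp: \<rho>_def)
  obtain c where c: "c > 0" "\<And>n. s n \<le> c * \<rho> ^ n" using upper[OF \<rho>(2)] by blast
  have "(\<lambda>n. root n c * \<rho>) \<longlonglongrightarrow> 1 * \<rho>"
    by (intro tendsto_intros LIMSEQ_root_const c)
  hence "\<forall>\<^sub>F n in sequentially. root n c * \<rho> < a"
    using \<rho> by (auto dest: order_tendstoD)
  thus "\<forall>\<^sub>F n in sequentially. root n (s n) < a"
    using eventually_gt_at_top[of 0]
  proof eventually_elim
    case (elim n)
    have "root n (s n) \<le> root n (c * \<rho> ^ n)" using c(2)[of n] elim by simp
    also have "\<dots> = root n c * \<rho>"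
      using \<rho> elim by (simp add: real_root_mult real_root_power_cancel)
    finally show ?case using elim by simp
  qed
qed

text \<open>Going back from a good length \<open>K\<close> to \<open>n\<close> loses at most the
  factor \<open>C * (\<mu> / l) ^ (K - n)\<close>. As \<open>K\<close> is linear in
  \<open>n\<close>, the total loss in powers of \<open>l\<close> is at most
  \<open>l ^ (3 * L * (n + 1))\<close>, which is harmless for \<open>l\<close> close to 1. The
  exponent \<open>2 * K\<close> in the hypothesis leaves room for two losses at the length
  \<open>K\<close>: one for polynomial factors, one for a growth bound whose base differs from the
  sharp one.\<close>

lemma geometric_lower_bound_of_sparse:
  fixes s :: "nat \<Rightarrow> real"
  assumes \<mu>: "\<mu> > 0"
    and sub: "\<And>\<rho>. \<mu> < \<rho> \<Longrightarrow> \<exists>C>0. \<forall>m n. s (m + n) \<le> s m * (C * \<rho> ^ n)"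
    and sparse: "\<And>l. 0 < l \<Longrightarrow> l < 1 \<Longrightarrow>
      \<exists>c>0. \<forall>n. \<exists>K\<ge>n. K \<le> L * (n + 1) \<and> c * (\<mu> ^ K * l ^ (2 * K)) \<le> s K"
    and \<rho>: "0 < \<rho>" "\<rho> < \<mu>"
  shows "\<exists>c>0. \<forall>n. c * \<rho> ^ n \<le> s n"
proof -
  \<comment> \<open>The exponent collects the losses: \<open>2 * K\<close> from
    \<open>sparse\<close> and \<open>K - n\<close> from \<open>sub\<close>, at most
    \<open>3 * K\<close> in all. The extra 1 keeps the index of the root positive when
    \<open>L = 0\<close>.\<close>
  define l where "l = root (3 * L + 1) (\<rho> / \<mu>)"
  have l: "0 < l" "l < 1" "l ^ (3 * L + 1) = \<rho> / \<mu>"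
    using \<rho> \<mu> real_root_pow_pos2[of "3 * L + 1" "\<rho> / \<mu>"] unfolding l_def by simp_all
  have l3: "\<rho> \<le> \<mu> * l ^ (3 * L)"
  proof -
    have "\<rho> = \<mu> * l ^ (3 * L + 1)" using l(3) \<mu> by simp
    also have "\<dots> \<le> \<mu> * l ^ (3 * L)"
      using l \<mu> by (intro mult_left_mono power_decreasing) auto
    finally show ?thesis .
  qed
  have "\<mu> < \<mu> / l" using l \<mu> by (simp add: field_simps)
  then obtain C where C: "C > 0" "\<And>m n. s (m + n) \<le> s m * (C * (\<mu> / l) ^ n)"
    using sub by blast
  obtain c where c: "c > 0"
    "\<And>n. \<exists>K\<ge>n. K \<le> L * (n + 1) \<and> c * (\<mu> ^ K * l ^ (2 * K)) \<le> s K"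
    using sparse[OF l(1,2)] by blast
  have "c / C * l ^ (3 * L) * \<rho> ^ n \<le> s n" for n
  proof -
    obtain K where K: "K \<ge> n" "K \<le> L * (n + 1)" "c * (\<mu> ^ K * l ^ (2 * K)) \<le> s K"
      using c(2) by blast
    obtain j where j: "K = n + j" using K(1) le_Suc_ex by blast
    have "c * (\<mu> ^ K * l ^ (2 * K)) \<le> s n * (C * (\<mu> / l) ^ j)"
      using K(3) C(2)[of n j] j by simp
    hence "c * (\<mu> ^ K * l ^ (2 * K)) * l ^ j \<le> s n * (C * (\<mu> / l) ^ j) * l ^ j"
      using l by (intro mult_right_mono) auto
    also have "\<dots> = \<mu> ^ j * (s n * C)" using l by (simp add: power_divide)
    finally have "c * (\<mu> ^ K * l ^ (2 * K)) * l ^ j \<le> \<mu> ^ j * (s n * C)" .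
    moreover have "l ^ (2 * K + j) = l ^ (2 * K) * l ^ j" "\<mu> ^ K = \<mu> ^ n * \<mu> ^ j"
      by (simp_all only: j power_add)
    ultimately have "\<mu> ^ j * (c * \<mu> ^ n * l ^ (2 * K + j)) \<le> \<mu> ^ j * (s n * C)"
      by (simp add: mult.assoc mult.left_commute)
    hence *: "c * \<mu> ^ n * l ^ (2 * K + j) \<le> s n * C"
      using \<mu> by (simp add: mult_le_cancel_left)
    have "2 * K + j \<le> 3 * K" using j by simp
    also have "\<dots> \<le> 3 * L * (n + 1)" using K(2) by simp
    finally have "l ^ (3 * L * (n + 1)) \<le> l ^ (2 * K + j)"
      using l by (intro power_decreasing) auto
    hence "c * \<mu> ^ n * l ^ (3 * L * (n + 1)) \<le> c * \<mu> ^ n * l ^ (2 * K + j)"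
      using c \<mu> by (intro mult_left_mono) auto
    moreover have "c * \<mu> ^ n * l ^ (3 * L * (n + 1)) = c * l ^ (3 * L) * (\<mu> * l ^ (3 * L)) ^ n"
    proof -
      have "3 * L * (n + 1) = 3 * L + 3 * L * n" by simp
      hence "l ^ (3 * L * (n + 1)) = l ^ (3 * L) * (l ^ (3 * L)) ^ n"
        by (simp only: power_add power_mult)
      thus ?thesis by (simp add: power_mult_distrib)
    qed
    moreover have "c * l ^ (3 * L) * \<rho> ^ n \<le> c * l ^ (3 * L) * (\<mu> * l ^ (3 * L)) ^ n"
      using c l \<rho> l3 by (intro mult_left_mono power_mono) auto
    ultimately have "c * l ^ (3 * L) * \<rho> ^ n \<le> s n * C" using * by linarith
    thus ?thesis using C by (simp add: field_simps)
  qed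
  moreover have "c / C * l ^ (3 * L) > 0" using c C l by simp
  ultimately show ?thesis by blast
qed

text \<open>Serves to absorb the number of terms of an average into a power of \<open>l\<close>;
  Bernoulli's inequality for \<open>(1 / l) ^ n\<close> provides the constant.\<close>

lemma linear_times_geometric_bounded:
  fixes l :: real
  assumes "0 < l" "l < 1"
  obtains b where "b > 0" "\<And>n. b * (real n + 1) * l ^ n \<le> 1"
proof
  define b where "b = min 1 (1 / l - 1)"
  show "b > 0" using assms by (simp add: b_def)
  fix n
  have "b * (real n + 1) \<le> 1 + real n * (1 / l - 1)"
  proof -
    have "b * real n \<le> (1 / l - 1) * real n" by (intro mult_right_mono) (auto simp: b_def)
    moreover have "b \<le> 1" by (simp add: b_def)
    ultimately show ?thesis by (simp add: algebra_simps)
  qed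
  also have "\<dots> \<le> (1 + (1 / l - 1)) ^ n"
    using assms by (intro Bernoulli_inequality) (simp add: field_simps)
  finally have "b * (real n + 1) \<le> (1 / l) ^ n" by simp
  thus "b * (real n + 1) * l ^ n \<le> 1" using assms by (simp add: power_divide field_simps)
qed

section \<open>Self-avoiding walks in quasi-transitive graphs\<close>

lemma is_walk_successively: "is_walk E xs \<longleftrightarrow> successively E xs"
proof (induction xs rule: induct_list012)
  case (3 x y zs)
  have all: "(\<forall>i. P i) \<longleftrightarrow> P 0 \<and> (\<forall>i. P (Suc i))" for P :: "nat \<Rightarrow> bool"
    by (metis nat.exhaust)
  have "is_walk E (x # y # zs) \<longleftrightarrow> E x y \<and> is_walk E (y # zs)"
    unfolding is_walk_def by (subst all) simp
  with 3 show ?case by simp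
qed (auto simp: is_walk_def)

lemma mem_saws_from:
  "xs \<in> saws_from E v n \<longleftrightarrow> length xs = Suc n \<and> hd xs = v \<and> distinct xs \<and> successively E xs"
  by (simp add: saws_from_def is_walk_successively)

text \<open>Loop erasure: when the next vertex already lies on the path, the path is cut back to it
  and stays self-avoiding.\<close>

lemma rtranclp_path:
  assumes "E\<^sup>*\<^sup>* x y"
  obtains xs where "xs \<noteq> []" "hd xs = x" "last xs = y" "distinct xs" "successively E xs"
proof -
  from assms have "\<exists>xs. xs \<noteq> [] \<and> hd xs = x \<and> last xs = y \<and> distinct xs \<and> successively E xs"
  proof (induction rule: rtranclp_induct)
    case base
    show ?case by (rule exI[of _ "[x]"]) simp
  next
    case (step y z)
    then obtain xs where xs: "xs \<noteq> []" "hd xs = x" "last xs = y" "distinct xs" "successively E xs"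
      by blast
    show ?case
    proof (cases "z \<in> set xs")
      case True
      then obtain as bs where ab: "xs = as @ z # bs" by (auto simp: in_set_conv_decomp)
      have "hd (as @ [z]) = x" using xs(2) ab by (cases as) auto
      thus ?thesis using xs ab
        by (intro exI[of _ "as @ [z]"]) (auto simp: successively_append_iff)
    next
      case False
      thus ?thesis using xs step.hyps
        by (intro exI[of _ "xs @ [z]"]) (auto simp: successively_append_iff)
    qed
  qed
  thus ?thesis using that by blast
qed

lemma walk_vertices:
  assumes "\<And>x y. E x y \<Longrightarrow> y \<in> V" "successively E xs" "xs \<noteq> []" "hd xs \<in> V"
  shows "set xs \<subseteq> V"
  using assms(2-4) by (induction xs rule: induct_list012) (auto intro: assms(1))

lemma finite_walks:
  assumes E: "\<And>x y. E x y \<Longrightarrow> y \<in> V" and fin: "\<And>x. x \<in> V \<Longrightarrow> finite {y. E x y}" and "v \<in> V"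
  shows "finite {xs. length xs = Suc n \<and> hd xs = v \<and> successively E xs}"
  using \<open>v \<in> V\<close>
proof (induction n arbitrary: v)
  case 0
  have "{xs. length xs = Suc 0 \<and> hd xs = v \<and> successively E xs} \<subseteq> {[v]}"
    by (auto simp: length_Suc_conv)
  thus ?case using finite_subset by blast
next
  case (Suc n)
  let ?A = "\<lambda>n v. {xs. length xs = Suc n \<and> hd xs = v \<and> successively E xs}"
  have "?A (Suc n) v \<subseteq> (\<Union>u\<in>{u. E v u}. (#) v ` ?A n u)"
  proof
    fix xs assume "xs \<in> ?A (Suc n) v"
    then obtain u ys where "xs = v # u # ys" "length ys = n" "E v u" "successively E (u # ys)"
      by (auto simp: length_Suc_conv)
    thus "xs \<in> (\<Union>u\<in>{u. E v u}. (#) v ` ?A n u)" by auto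
  qed
  moreover have "finite (\<Union>u\<in>{u. E v u}. (#) v ` ?A n u)"
    using Suc E fin by (intro finite_UN_I finite_imageI) auto
  ultimately show ?case using finite_subset by blast
qed

section \<open>Counting self-avoiding walks in locally finite graphs\<close>

locale locally_finite_graph =
  fixes V :: "'v set" and E :: "'v \<Rightarrow> 'v \<Rightarrow> bool"
  assumes simple: "simple_graph V E"
    and finite_neighbours: "v \<in> V \<Longrightarrow> finite {u. E v u}"
begin

lemma edge_in: "E x y \<Longrightarrow> x \<in> V" "E x y \<Longrightarrow> y \<in> V"
  and edge_sym: "E x y \<Longrightarrow> E y x"
  and edge_irrefl: "\<not> E x x"
  using simple by (auto simp: simple_graph_def)

lemma edge_commute: "(\<lambda>x y. E y x) = E"
  using edge_sym by blast

lemma finite_saws_from: "v \<in> V \<Longrightarrow> finite (saws_from E v n)"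
  by (rule finite_subset[OF _ finite_walks[of E V v n]])
     (auto simp: mem_saws_from edge_in intro: finite_neighbours)

lemma saw_vertices: "v \<in> V \<Longrightarrow> xs \<in> saws_from E v n \<Longrightarrow> set xs \<subseteq> V"
  by (rule walk_vertices[of E]) (auto simp: mem_saws_from edge_in)

text \<open>The two pieces of a cut walk share the vertex at position \<open>m\<close>. The second
  piece starts at a vertex that varies with the walk, hence the bound \<open>T\<close> over all
  vertices; the first keeps the start \<open>v\<close>. This asymmetric form also serves a graph
  without symmetries.\<close>

lemma saw_count_add_le:
  assumes v: "v \<in> V" and T: "\<And>u. u \<in> V \<Longrightarrow> real (saw_count E u n) \<le> T"
  shows "real (saw_count E v (m + n)) \<le> real (saw_count E v m) * T"
proof -
  let ?f = "\<lambda>xs. (take (Suc m) xs, drop m xs)"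
  let ?S = "Sigma (saws_from E v m) (\<lambda>ys. saws_from E (last ys) n)"
  have last_in: "last ys \<in> V" if "ys \<in> saws_from E v m" for ys
    using saw_vertices[OF v that] that by (auto simp: mem_saws_from intro!: last_in_set)
  have fin: "finite ?S"
    using last_in by (intro finite_SigmaI finite_saws_from v) auto
  have "inj_on ?f (saws_from E v (m + n))"
  proof (rule inj_onI)
    fix xs ys assume "?f xs = ?f ys"
    hence "take m xs = take m ys" "drop m xs = drop m ys"
      by (metis prod.inject take_take min.absorb1 le_SucI order_refl, simp)
    thus "xs = ys" by (metis append_take_drop_id)
  qed
  moreover have "?f ` saws_from E v (m + n) \<subseteq> ?S"
  proof safe
    fix xs assume "xs \<in> saws_from E v (m + n)"
    hence xs: "length xs = Suc (m + n)" "hd xs = v" "distinct xs" "successively E xs"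
      by (auto simp: mem_saws_from)
    have eq: "xs = take (Suc m) xs @ drop (Suc m) xs" "xs = take m xs @ drop m xs" by simp_all
    have s: "successively E (take (Suc m) xs)" "successively E (drop m xs)"
      using xs(4) eq successively_append_iff by metis+
    show "take (Suc m) xs \<in> saws_from E v m"
      using xs s by (simp add: mem_saws_from hd_take)
    show "drop m xs \<in> saws_from E (last (take (Suc m) xs)) n"
      using xs s by (simp add: mem_saws_from hd_drop_conv_nth take_Suc_conv_app_nth)
  qed
  ultimately have "saw_count E v (m + n) \<le> card ?S"
    unfolding saw_count_def by (rule card_inj_on_le[OF _ _ fin])
  also have "card ?S = (\<Sum>ys\<in>saws_from E v m. saw_count E (last ys) n)"
    using last_in by (subst card_SigmaI) (auto simp: saw_count_def intro: finite_saws_from v)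
  finally have "real (saw_count E v (m + n)) \<le> (\<Sum>ys\<in>saws_from E v m. real (saw_count E (last ys) n))"
    by (metis of_nat_le_iff of_nat_sum)
  also have "\<dots> \<le> (\<Sum>ys\<in>saws_from E v m. T)"
    by (intro sum_mono T last_in)
  finally show ?thesis by (simp add: saw_count_def)
qed

text \<open>If no self-avoiding walk had \<open>n\<close> steps, every path from \<open>v\<close>
  would have fewer than \<open>n\<close> steps, as a longer one could be truncated; then only
  finitely many vertices could be reached.\<close>

lemma saw_count_pos:
  assumes "infinite V" "connected_graph V E" and v: "v \<in> V"
  shows "saw_count E v n \<ge> 1"
proof (rule ccontr)
  assume "\<not> saw_count E v n \<ge> 1"
  hence e: "saws_from E v n = {}" using finite_saws_from[OF v, of n] by (simp add: saw_count_def not_le)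
  have "V \<subseteq> (\<Union>k<n. last ` saws_from E v k)"
  proof
    fix u assume "u \<in> V"
    hence "E\<^sup>*\<^sup>* v u" using assms by (auto simp: connected_graph_def)
    then obtain xs where xs: "xs \<noteq> []" "hd xs = v" "last xs = u" "distinct xs" "successively E xs"
      by (rule rtranclp_path)
    have "length xs \<le> n"
    proof (rule ccontr)
      assume "\<not> length xs \<le> n"
      moreover have "successively E (take (Suc n) xs)"
        using xs(5) by (metis append_take_drop_id successively_append_iff)
      ultimately have "take (Suc n) xs \<in> saws_from E v n"
        using xs by (simp add: mem_saws_from hd_take)
      thus False using e by simp
    qed
    moreover have "xs \<in> saws_from E v (length xs - 1)"
      using xs by (simp add: mem_saws_from)
    moreover have "length xs - 1 < n" using calculation xs by (cases xs) auto
    ultimately show "u \<in> (\<Union>k<n. last ` saws_from E v k)" using xs(3) by blast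
  qed
  moreover have "finite (\<Union>k<n. last ` saws_from E v k)"
    using finite_saws_from[OF v] by auto
  ultimately show False using assms(1) finite_subset by blast
qed

end

lemma ex_ge_average:
  fixes f :: "'i \<Rightarrow> real"
  assumes "finite A" "A \<noteq> {}" "S \<le> sum f A"
  obtains x where "x \<in> A" "S \<le> real (card A) * f x"
proof -
  have "\<exists>x\<in>A. S \<le> real (card A) * f x"
  proof (rule ccontr)
    assume "\<not> ?thesis"
    hence "sum f A < (\<Sum>x\<in>A. S / real (card A))"
      using assms by (intro sum_strict_mono) (auto simp: field_simps not_le card_gt_0_iff)
    also have "\<dots> = S" using assms by simp
    finally show False using assms by simp
  qed
  thus ?thesis using that by blast
qed

section \<open>Growth rate of a quasi-transitive graph and its independence of the starting
  vertex\<close>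

context locally_finite_graph
begin

text \<open>A walk \<open>w\<close> from \<open>u\<close> is cut at the first vertex
  \<open>x\<close> of \<open>p\<close> that lies on it. Following \<open>p\<close> up to
  \<open>x\<close> and then \<open>w\<close> backwards or forwards gives two self-avoiding walks
  from \<open>v\<close>, with \<open>n + 2 * i\<close> steps together, where \<open>i\<close> is the
  position of \<open>x\<close> on \<open>p\<close>. This transfers growth from \<open>u\<close> to
  \<open>v\<close> even if no automorphism relates them.\<close>

lemma saw_count_le_via_path:
  assumes p: "p \<noteq> []" "hd p = v" "last p = u" "distinct p" "successively E p" and v: "v \<in> V"
  shows "saw_count E u n \<le>
    (\<Sum>(i, k)\<in>{..<length p} \<times> {..n}. saw_count E v (i + k) * saw_count E v (i + (n - k)))"
proof -
  let ?I = "{..<length p} \<times> {..n}"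
  \<comment> \<open>The inverse of the cutting: both walks drop their common initial segment and the
    first is reversed. The second drops \<open>Suc i\<close> vertices so that \<open>x\<close> is
    not repeated.\<close>
  let ?B = "\<lambda>(i, k). (\<lambda>(a, b). rev (drop i a) @ drop (Suc i) b) `
      (saws_from E v (i + k) \<times> saws_from E v (i + (n - k)))"
  have "saws_from E u n \<subseteq> (\<Union>ik\<in>?I. ?B ik)"
  proof
    fix w assume "w \<in> saws_from E u n"
    hence w: "length w = Suc n" "hd w = u" "distinct w" "successively E w"
      by (auto simp: mem_saws_from)
    have "w \<noteq> []" using w(1) by auto
    hence "\<exists>x\<in>set p. x \<in> set w" using w(2) p(1,3) last_in_set hd_in_set by metis
    then obtain ys x zs where q: "p = ys @ x # zs" "x \<in> set w" "\<forall>y\<in>set ys. y \<notin> set w"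
      using split_list_first_prop[of p "\<lambda>x. x \<in> set w"] by blast
    obtain w1 w2 where s: "w = w1 @ x # w2" using q(2) by (auto simp: in_set_conv_decomp)
    let ?a = "ys @ x # rev w1" and ?b = "ys @ x # w2"
    have hd: "hd ?a = v" "hd ?b = v" using p(2) q(1) by (cases ys; simp)+
    have succ: "successively E (ys @ [x])" "successively E (x # w2)" "successively E (w1 @ [x])"
      using p(5) w(4) by (auto simp: q(1) s successively_append_iff successively_Cons)
    have "successively E (rev (w1 @ [x]))"
      using succ(3) by (simp only: successively_rev edge_commute)
    hence "successively E (x # rev w1)" by simp
    hence a: "?a \<in> saws_from E v (length ys + length w1)"
      using hd succ w(3) p(4) q s
      by (auto simp: mem_saws_from successively_append_iff simp del: successively_rev)
    have b: "?b \<in> saws_from E v (length ys + (n - length w1))"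
      using hd succ w(1,3) p(4) q s by (auto simp: mem_saws_from successively_append_iff)
    have "w \<in> ?B (length ys, length w1)"
      using a b s by (auto intro!: image_eqI[where x = "(?a, ?b)"])
    moreover have "(length ys, length w1) \<in> ?I" using q(1) s w(1) by auto
    ultimately show "w \<in> (\<Union>ik\<in>?I. ?B ik)" by blast
  qed
  moreover have fin: "finite (?B ik)" for ik
    using v by (auto simp: split_beta intro!: finite_imageI finite_saws_from)
  ultimately have "saw_count E u n \<le> card (\<Union>ik\<in>?I. ?B ik)"
    unfolding saw_count_def by (intro card_mono finite_UN_I) auto
  also have "\<dots> \<le> (\<Sum>ik\<in>?I. card (?B ik))" by (rule card_UN_le) auto
  also have "\<dots> \<le> (\<Sum>(i, k)\<in>?I. saw_count E v (i + k) * saw_count E v (i + (n - k)))"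
  proof (rule sum_mono)
    fix ik
    show "card (?B ik) \<le> (case ik of (i, k) \<Rightarrow> saw_count E v (i + k) * saw_count E v (i + (n - k)))"
      using v by (auto simp: split_beta saw_count_def card_cartesian_product[symmetric]
          intro!: card_image_le finite_saws_from)
  qed
  finally show ?thesis .
qed

lemma saw_count_le_aut:
  assumes \<alpha>: "graph_aut V E \<alpha>" and v: "v \<in> V"
  shows "saw_count E v n \<le> saw_count E (\<alpha> v) n"
proof -
  have bij: "bij_betw \<alpha> V V" and hom: "\<And>x y. x \<in> V \<Longrightarrow> y \<in> V \<Longrightarrow> E x y \<longleftrightarrow> E (\<alpha> x) (\<alpha> y)"
    using \<alpha> by (auto simp: graph_aut_def)
  have inj: "inj_on \<alpha> V" and "\<alpha> v \<in> V" using bij v by (auto simp: bij_betw_def)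
  have sub: "set xs \<subseteq> V" if "xs \<in> saws_from E v n" for xs
    using saw_vertices[OF v that] .
  have "inj_on (map \<alpha>) (saws_from E v n)"
  proof (rule inj_onI)
    fix xs ys assume "xs \<in> saws_from E v n" "ys \<in> saws_from E v n" "map \<alpha> xs = map \<alpha> ys"
    thus "xs = ys" using sub inj_on_subset[OF inj, of "set xs \<union> set ys"]
      by (intro map_inj_on[of \<alpha> xs ys]) auto
  qed
  moreover have "map \<alpha> ` saws_from E v n \<subseteq> saws_from E (\<alpha> v) n"
  proof safe
    fix xs assume xs: "xs \<in> saws_from E v n"
    hence "xs \<noteq> []" by (auto simp: mem_saws_from)
    moreover have "successively (\<lambda>x y. E (\<alpha> x) (\<alpha> y)) xs"
    proof (rule successively_mono[of E xs])
      show "successively E xs" using xs by (simp add: mem_saws_from)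
    qed (use hom sub[OF xs] in blast)
    ultimately show "map \<alpha> xs \<in> saws_from E (\<alpha> v) n"
      using xs sub[OF xs] inj
      by (auto simp: mem_saws_from successively_map distinct_map hd_map intro: inj_on_subset)
  qed
  ultimately show ?thesis
    unfolding saw_count_def using \<open>\<alpha> v \<in> V\<close> by (intro card_inj_on_le finite_saws_from) auto
qed

text \<open>Fekete's argument applies to the maximum \<open>t n\<close> over the orbit
  representatives in \<open>W\<close>, as it bounds the counts at all vertices; this yields \<mu>
  and the uniform upper bounds. The lower bound at a single vertex comes from cutting the walks that
  attain the maximum.\<close>

theorem quasi_transitive_saw_growth:
  assumes inf: "infinite V" and conn: "connected_graph V E"
    and W: "finite W" "W \<subseteq> V" and qt: "\<And>v. v \<in> V \<Longrightarrow> \<exists>\<alpha>. graph_aut V E \<alpha> \<and> \<alpha> v \<in> W"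
  obtains \<mu> :: real where "\<mu> \<ge> 1"
    and "\<And>\<rho>. \<mu> < \<rho> \<Longrightarrow> \<exists>C>0. \<forall>v\<in>V. \<forall>n. real (saw_count E v n) \<le> C * \<rho> ^ n"
    and "\<And>v \<rho>. v \<in> V \<Longrightarrow> 0 < \<rho> \<Longrightarrow> \<rho> < \<mu> \<Longrightarrow> \<exists>c>0. \<forall>n. c * \<rho> ^ n \<le> real (saw_count E v n)"
proof -
  define t where "t n = Max ((\<lambda>w. real (saw_count E w n)) ` W)" for n
  have "V \<noteq> {}" using inf by auto
  hence Wne: "W \<noteq> {}" using qt by blast
  have t_ge: "real (saw_count E v n) \<le> t n" if v: "v \<in> V" for v n
  proof -
    obtain \<alpha> where "graph_aut V E \<alpha>" "\<alpha> v \<in> W" using qt[OF v] by blast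
    hence "real (saw_count E v n) \<le> real (saw_count E (\<alpha> v) n)" using saw_count_le_aut v by simp
    also have "\<dots> \<le> t n" unfolding t_def using W \<open>\<alpha> v \<in> W\<close> by (intro Max_ge) auto
    finally show ?thesis .
  qed
  have t_ex: "\<exists>w\<in>W. t n = real (saw_count E w n)" for n
  proof -
    have "t n \<in> (\<lambda>w. real (saw_count E w n)) ` W"
      unfolding t_def using W Wne by (intro Max_in) auto
    thus ?thesis by blast
  qed
  have t_ge1: "t n \<ge> 1" for n
    using t_ex[of n] saw_count_pos[OF inf conn] W(2) by (metis of_nat_1 of_nat_le_iff subsetD)
  have t_add: "t (m + n) \<le> t m * t n" for m n
  proof -
    obtain w where w: "w \<in> W" "t (m + n) = real (saw_count E w (m + n))" using t_ex by blast
    hence "w \<in> V" using W by blast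
    have "t (m + n) \<le> real (saw_count E w m) * t n"
      using saw_count_add_le[OF \<open>w \<in> V\<close>, of n "t n" m] t_ge w(2) by simp
    also have "\<dots> \<le> t m * t n" using t_ge[OF \<open>w \<in> V\<close>] t_ge1[of n] by (intro mult_right_mono) auto
    finally show ?thesis .
  qed
  \<comment> \<open>Taking the infimum gives \<open>\<mu> ^ n \<le> t n\<close> for every
    \<open>n\<close> without an error term.\<close>
  define \<mu> where "\<mu> = (INF n\<in>{1..}. root n (t n))"
  have root_ge1: "1 \<le> root n (t n)" if "n \<in> {1..}" for n using that t_ge1[of n] by simp
  have bdd: "bdd_below ((\<lambda>n. root n (t n)) ` {1..})" using root_ge1 by (rule bdd_belowI2)
  have \<mu>1: "\<mu> \<ge> 1" unfolding \<mu>_def using root_ge1 by (intro cINF_greatest) auto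
  have t_lower: "\<mu> ^ n \<le> t n" for n
  proof (cases "n = 0")
    case True
    thus ?thesis using t_ge1[of 0] by simp
  next
    case False
    hence "\<mu> \<le> root n (t n)" unfolding \<mu>_def by (intro cINF_lower bdd) auto
    hence "\<mu> ^ n \<le> root n (t n) ^ n" using \<mu>1 by (intro power_mono) auto
    also have "\<dots> = t n" using t_ge1[of n] False by (intro real_root_pow_pos2) auto
    finally show ?thesis .
  qed
  have t_upper: "\<exists>C>0. \<forall>n. t n \<le> C * \<rho> ^ n" if "\<mu> < \<rho>" for \<rho>
  proof -
    have "\<exists>k\<in>{1..}. root k (t k) < \<rho>"
      using that bdd unfolding \<mu>_def by (subst (asm) cINF_less_iff) auto
    then obtain k where k: "k \<ge> 1" "root k (t k) < \<rho>" by auto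
    have "t k = root k (t k) ^ k" using t_ge1[of k] k by (intro real_root_pow_pos2[symmetric]) auto
    also have "\<dots> \<le> \<rho> ^ k" using k root_ge1[of k] by (intro power_mono) auto
    finally have tk: "t k \<le> \<rho> ^ k" .
    define C where "C = (\<Sum>r<k. t r)"
    have C: "t r \<le> C" if "r < k" for r
      unfolding C_def using that t_ge1 by (intro member_le_sum) (auto intro: order_trans[OF zero_le_one])
    have "C > 0" using C[of 0] t_ge1[of 0] k by simp
    have "\<rho> \<ge> 1" using that \<mu>1 by simp
    have q: "t (q * k + r) \<le> \<rho> ^ (q * k) * t r" for q r
    proof (induction q)
      case (Suc q)
      have "t (Suc q * k + r) \<le> t k * t (q * k + r)" using t_add[of k "q * k + r"] by (simp add: add_ac)
      also have "\<dots> \<le> \<rho> ^ k * (\<rho> ^ (q * k) * t r)"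
        using Suc tk t_ge1 \<open>\<rho> \<ge> 1\<close> by (intro mult_mono) (auto intro: order_trans[OF zero_le_one])
      finally show ?case by (simp add: power_add mult_ac)
    qed simp
    have "t n \<le> C * \<rho> ^ n" for n
    proof -
      have "t n \<le> \<rho> ^ (n div k * k) * t (n mod k)" using q[of "n div k" "n mod k"] by simp
      also have "\<dots> \<le> \<rho> ^ n * C"
        using C[of "n mod k"] k \<open>\<rho> \<ge> 1\<close> t_ge1[of "n mod k"] \<open>C > 0\<close>
        by (intro mult_mono power_increasing) auto
      finally show ?thesis by (simp add: mult.commute)
    qed
    with \<open>C > 0\<close> show ?thesis by blast
  qed
  have upper: "\<exists>C>0. \<forall>v\<in>V. \<forall>n. real (saw_count E v n) \<le> C * \<rho> ^ n" if "\<mu> < \<rho>" for \<rho>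
    using t_upper[OF that] t_ge order_trans by blast
  have lower: "\<exists>c>0. \<forall>n. c * \<rho> ^ n \<le> real (saw_count E v n)"
    if v: "v \<in> V" and \<rho>: "0 < \<rho>" "\<rho> < \<mu>" for v \<rho>
  proof -
    define s where "s n = real (saw_count E v n)" for n
    have s_nonneg: "s n \<ge> 0" for n by (simp add: s_def)
    have "\<forall>w\<in>W. \<exists>p. p \<noteq> [] \<and> hd p = v \<and> last p = w \<and> distinct p \<and> successively E p"
      using conn W(2) v rtranclp_path unfolding connected_graph_def by (metis subsetD)
    then obtain p where p: "\<And>w. w \<in> W \<Longrightarrow>
        p w \<noteq> [] \<and> hd (p w) = v \<and> last (p w) = w \<and> distinct (p w) \<and> successively E (p w)"
      by metis
    define d where "d = Suc (\<Sum>w\<in>W. length (p w))"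
    have d: "length (p w) \<le> d" if "w \<in> W" for w
      using member_le_sum[of w W "\<lambda>w. length (p w)"] that W by (simp add: d_def)
    have sub: "\<exists>C>0. \<forall>m n. s (m + n) \<le> s m * (C * \<rho> ^ n)" if \<rho>: "\<mu> < \<rho>" for \<rho>
    proof -
      obtain C where "C > 0" "\<And>v n. v \<in> V \<Longrightarrow> real (saw_count E v n) \<le> C * \<rho> ^ n"
        using upper[OF \<rho>] by blast
      thus ?thesis unfolding s_def using saw_count_add_le[OF v] by blast
    qed
    \<comment> \<open>Walks with \<open>2 * n\<close> steps are cut, so that the longer of the two
      pieces has at least \<open>n\<close> steps. The path adds at most \<open>d\<close> steps,
      which explains the window \<open>(2 + d) * (n + 1)\<close>.\<close>
    have "\<exists>c>0. \<forall>n. \<exists>K\<ge>n. K \<le> (2 + d) * (n + 1) \<and> c * (\<mu> ^ K * l ^ (2 * K)) \<le> s K"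
      if l: "0 < l" "l < 1" for l
    proof -
      have "\<mu> < \<mu> / l" using l \<mu>1 by (simp add: field_simps)
      then obtain C where C: "C > 0" "\<And>n. s n \<le> C * (\<mu> / l) ^ n"
        using upper v unfolding s_def by blast
      obtain b0 where b0: "b0 > 0" "\<And>n. b0 * (real n + 1) * l ^ n \<le> 1"
        using linear_times_geometric_bounded[OF l] by blast
      define D where "D = real d * C * \<mu> ^ (2 * d)"
      have "d > 0" by (simp add: d_def)
      hence "D > 0" using C \<mu>1 by (simp add: D_def)
      \<comment> \<open>The upper bound for \<open>s b\<close> turns the lower bound for the product
        into one for \<open>s a\<close>. Half of \<open>l ^ (2 * a)\<close> pays for the base
        \<open>\<mu> / l\<close> in the bound for \<open>s b\<close>, as \<open>b \<le> a\<close>;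
        the other half pays for the linear number of summands. The 2 comes from
        \<open>2 * n + 1 \<le> 2 * (a + 1)\<close>.\<close>
      have main: "b0 / (2 * D) * (\<mu> ^ a * l ^ (2 * a)) \<le> s a"
        if ab: "b \<le> a" "a + b = 2 * n + 2 * i" "i \<le> d"
          and le: "\<mu> ^ (2 * n) \<le> real (d * (2 * n + 1)) * (s a * s b)" for a b n i
      proof -
        have "n \<le> a" using ab by simp
        have "\<mu> ^ (2 * n) \<le> real (d * (2 * n + 1)) * (s a * (C * (\<mu> / l) ^ b))"
          by (rule order_trans[OF le]) (intro mult_left_mono C(2) s_nonneg of_nat_0_le_iff)
        hence "\<mu> ^ (2 * n) * (\<mu> ^ (2 * i) * l ^ b) \<le>
            real (d * (2 * n + 1)) * (s a * (C * (\<mu> / l) ^ b)) * (\<mu> ^ (2 * i) * l ^ b)"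
          using \<mu>1 l by (intro mult_right_mono) auto
        also have "\<dots> = \<mu> ^ b * ((2 * real n + 1) * (s a * (real d * C * \<mu> ^ (2 * i))))"
          using l by (simp add: power_divide) (simp add: algebra_simps)
        also have "\<mu> ^ (2 * n) * (\<mu> ^ (2 * i) * l ^ b) = \<mu> ^ b * (\<mu> ^ a * l ^ b)"
        proof -
          have "\<mu> ^ (2 * n) * \<mu> ^ (2 * i) = \<mu> ^ b * \<mu> ^ a"
            using ab(2) by (simp only: power_add[symmetric] add.commute)
          thus ?thesis by (simp only: mult.assoc[symmetric])
        qed
        finally have "\<mu> ^ a * l ^ b \<le> (2 * real n + 1) * (s a * (real d * C * \<mu> ^ (2 * i)))"
          using \<mu>1 by (simp add: mult_le_cancel_left)
        also have "\<dots> \<le> (2 * (real a + 1)) * (s a * D)"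
          unfolding D_def using \<open>n \<le> a\<close> ab(3) C(1) \<mu>1 s_nonneg
          by (intro mult_mono power_increasing) auto
        finally have 1: "\<mu> ^ a * l ^ b \<le> (2 * (real a + 1)) * (s a * D)" .
        have "b0 * (\<mu> ^ a * l ^ (2 * a)) = b0 * l ^ a * (\<mu> ^ a * l ^ a)"
          by (simp add: mult_2 power_add)
        also have "\<dots> \<le> b0 * l ^ a * (\<mu> ^ a * l ^ b)"
          using ab(1) b0 l \<mu>1 by (intro mult_left_mono power_decreasing) auto
        also have "\<dots> \<le> b0 * l ^ a * ((2 * (real a + 1)) * (s a * D))"
          using 1 b0 l by (intro mult_left_mono) auto
        also have "\<dots> = (b0 * (real a + 1) * l ^ a) * (2 * D * s a)" by simp
        also have "\<dots> \<le> 1 * (2 * D * s a)"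
          using b0(2) \<open>D > 0\<close> s_nonneg by (intro mult_right_mono) auto
        finally show ?thesis using \<open>D > 0\<close> by (simp add: field_simps)
      qed
      have "\<exists>K\<ge>n. K \<le> (2 + d) * (n + 1) \<and> b0 / (2 * D) * (\<mu> ^ K * l ^ (2 * K)) \<le> s K" for n
      proof -
        obtain w where w: "w \<in> W" "t (2 * n) = real (saw_count E w (2 * n))" using t_ex by blast
        note pw = p[OF w(1)]
        let ?A = "{..<length (p w)} \<times> {..2 * n}"
        have "saw_count E w (2 * n) \<le> (\<Sum>(i, k)\<in>?A. saw_count E v (i + k) * saw_count E v (i + (2 * n - k)))"
          using pw v by (intro saw_count_le_via_path) auto
        hence "real (saw_count E w (2 * n)) \<le>
            real (\<Sum>(i, k)\<in>?A. saw_count E v (i + k) * saw_count E v (i + (2 * n - k)))"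
          by (simp only: of_nat_le_iff)
        also have "\<dots> = (\<Sum>(i, k)\<in>?A. s (i + k) * s (i + (2 * n - k)))"
          by (simp add: s_def split_beta)
        finally have S: "\<mu> ^ (2 * n) \<le> (\<Sum>(i, k)\<in>?A. s (i + k) * s (i + (2 * n - k)))"
          using t_lower[of "2 * n"] w(2) by simp
        have A: "finite ?A" "?A \<noteq> {}" using pw by auto
        obtain x where x: "x \<in> ?A"
          "\<mu> ^ (2 * n) \<le> real (card ?A) * (case x of (i, k) \<Rightarrow> s (i + k) * s (i + (2 * n - k)))"
          by (rule ex_ge_average[OF A S])
        obtain i k where ik: "x = (i, k)" by force
        define a b where "a = i + k" and "b = i + (2 * n - k)"
        have i: "i < length (p w)" "k \<le> 2 * n" "i \<le> d" using x(1) ik d[OF w(1)] by auto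
        have "card ?A \<le> d * (2 * n + 1)"
          using d[OF w(1)] unfolding card_cartesian_product by (intro mult_mono) auto
        hence "real (card ?A) * (s a * s b) \<le> real (d * (2 * n + 1)) * (s a * s b)"
          using s_nonneg by (intro mult_right_mono mult_nonneg_nonneg) (simp_all only: of_nat_le_iff)
        hence le: "\<mu> ^ (2 * n) \<le> real (d * (2 * n + 1)) * (s a * s b)"
          using x(2) ik by (simp add: a_def b_def)
        have ab: "a + b = 2 * n + 2 * i" using i by (simp add: a_def b_def)
        have bound: "a \<le> (2 + d) * (n + 1)" "b \<le> (2 + d) * (n + 1)"
          using i by (simp_all add: a_def b_def algebra_simps)
        show ?thesis
        proof (cases "b \<le> a")
          case True
          thus ?thesis using main[OF True ab i(3) le] bound ab by (intro exI[of _ a]) auto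
        next
          case False
          hence "a \<le> b" "b + a = 2 * n + 2 * i" using ab by auto
          thus ?thesis using main[of a b n i] i(3) le bound by (intro exI[of _ b]) (auto simp: mult.commute)
        qed
      qed
      moreover have "b0 / (2 * D) > 0" using b0 \<open>D > 0\<close> by simp
      ultimately show ?thesis by blast
    qed
    hence "\<exists>c>0. \<forall>n. c * \<rho> ^ n \<le> s n"
      using \<mu>1 sub \<rho> by (intro geometric_lower_bound_of_sparse[of \<mu> s "2 + d" \<rho>]) auto
    thus ?thesis by (simp add: s_def)
  qed
  show ?thesis using that \<mu>1 upper lower by blast
qed

end

section \<open>Lifting walks through gadgets\<close>

text \<open>The condition under which the entry and exit edges of each crossed gadget differ, so
  that the crossing is counted by the gadget series.\<close>

fun nonbacktracking :: "'v list \<Rightarrow> bool" where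
  "nonbacktracking (a # b # c # vs) \<longleftrightarrow> a \<noteq> c \<and> nonbacktracking (b # c # vs)"
| "nonbacktracking _ \<longleftrightarrow> True"

lemma nonbacktracking_of_distinct: "distinct vs \<Longrightarrow> nonbacktracking vs"
  by (induction vs rule: nonbacktracking.induct) auto

text \<open>Collapsing equal consecutive first components reads the route off a lift; this is the
  step for one gadget.\<close>

lemma remdups_adj_const_block:
  assumes "r \<noteq> []"
  shows "remdups_adj (map (\<lambda>_. v) r @ vs) = remdups_adj (v # vs)"
  using assms by (induction r rule: induct_list012) auto

lemma gadget_pathsD:
  assumes "r \<in> gadget_paths A G p q"
  shows "r \<noteq> []" "hd r = p" "last r = q" "set r \<subseteq> A" "distinct r" "successively G r"
    "p \<in> set r" "q \<in> set r"
  using assms by (auto simp: gadget_paths_def is_walk_successively)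

text \<open>The gadgets depend on the vertex through \<open>GV\<close> alone and share the adjacency
  \<open>GE\<close> on one type, in which both kinds can be placed side by side. Colours enter
  later, through the weights of crossings. Having finitely many gadget sets makes length and weight
  bounds uniform in the vertex, in place of automorphisms.\<close>

locale gadget_replacement = locally_finite_graph V E
  for V :: "'v set" and E +
  fixes GV :: "'v \<Rightarrow> 'c set" and GE :: "'c \<Rightarrow> 'c \<Rightarrow> bool" and port :: "'v \<Rightarrow> 'v \<Rightarrow> 'c"
  assumes degree_le: "v \<in> V \<Longrightarrow> card {u. E v u} \<le> 3"
    and finite_gadget: "v \<in> V \<Longrightarrow> finite (GV v)"
    and finitely_many_gadgets: "finite (GV ` V)"
    and gadget_sym: "GE a b \<Longrightarrow> GE b a"
    and gadget_irrefl: "\<not> GE a a"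
    and gadget_connected: "v \<in> V \<Longrightarrow> a \<in> GV v \<Longrightarrow> b \<in> GV v \<Longrightarrow> gadget_paths (GV v) GE a b \<noteq> {}"
    and port_in: "E v u \<Longrightarrow> port v u \<in> GV v"
begin

abbreviation VT :: "('v \<times> 'c) set" where "VT \<equiv> Sigma V GV"

definition ET :: "'v \<times> 'c \<Rightarrow> 'v \<times> 'c \<Rightarrow> bool" where
  "ET p q \<longleftrightarrow> p \<in> VT \<and> q \<in> VT \<and>
     ((fst p = fst q \<and> GE (snd p) (snd q)) \<or>
      (E (fst p) (fst q) \<and> snd p = port (fst p) (fst q) \<and> snd q = port (fst q) (fst p)))"

sublocale T: locally_finite_graph VT ET
proof
  show "simple_graph VT ET"
    unfolding simple_graph_def ET_def
    using edge_sym edge_irrefl gadget_sym gadget_irrefl by (intro conjI allI impI) metis+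
next
  fix p assume "p \<in> VT"
  hence "{q. ET p q} \<subseteq> Sigma (insert (fst p) {u. E (fst p) u}) GV" "fst p \<in> V"
    by (auto simp: ET_def)
  moreover from this have "finite (Sigma (insert (fst p) {u. E (fst p) u}) GV)"
    using finite_neighbours edge_in finite_gadget by (intro finite_SigmaI) auto
  ultimately show "finite {q. ET p q}" using finite_subset by blast
qed

abbreviation paths :: "'v \<Rightarrow> 'c \<Rightarrow> 'c \<Rightarrow> 'c list set" where
  "paths v \<equiv> gadget_paths (GV v) GE"

text \<open>A superset, formed without adjacency, of what a self-avoiding walk can trace in one
  visit to a gadget; it is used for finiteness and uniform bounds.\<close>

definition simple_lists :: "'v \<Rightarrow> 'c list set" where
  "simple_lists v = {r. set r \<subseteq> GV v \<and> distinct r}"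

text \<open>What a walk arriving from \<open>u\<close> can trace in the gadget at \<open>v\<close>
  if it stops there.\<close>

definition ends :: "'v \<Rightarrow> 'v \<Rightarrow> 'c list set" where
  "ends u v = {r. r \<noteq> [] \<and> hd r = port v u \<and> set r \<subseteq> GV v \<and> distinct r \<and> successively GE r}"

lemma finite_simple_lists: "v \<in> V \<Longrightarrow> finite (simple_lists v)"
  unfolding simple_lists_def by (intro finite_subset_distinct finite_gadget)

lemma paths_subset: "paths v p q \<subseteq> simple_lists v"
  and ends_subset: "ends u v \<subseteq> simple_lists v"
  by (auto simp: simple_lists_def ends_def dest: gadget_pathsD)

lemma finite_paths: "v \<in> V \<Longrightarrow> finite (paths v p q)"
  using finite_subset[OF paths_subset finite_simple_lists] .

text \<open>The lifts of a walk \<^term>\<open>vs\<close> in the original graph that is entered along an edge from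
  \<^term>\<open>u\<close>: every gadget but the last is crossed between the ports of the two adjacent edges of the
  walk, and \<^term>\<open>Z\<close> prescribes the initial segments allowed in the last gadget.\<close>

fun lifts :: "('v \<Rightarrow> 'v \<Rightarrow> 'c list set) \<Rightarrow> 'v \<Rightarrow> 'v list \<Rightarrow> ('v \<times> 'c) list set" where
  "lifts Z u [] = {}"
| "lifts Z u [v] = map (Pair v) ` Z u v"
| "lifts Z u (v # v' # vs) = (\<lambda>(r, t). map (Pair v) r @ t) `
     (paths v (port v u) (port v v') \<times> lifts Z v (v' # vs))"

lemma lifts_ConsE:
  assumes "xs \<in> lifts Z u (v # v' # vs)"
  obtains r t where "xs = map (Pair v) r @ t" "r \<in> paths v (port v u) (port v v')"
    "t \<in> lifts Z v (v' # vs)"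
  using assms by auto

lemma lifts_hd:
  assumes "xs \<in> lifts Z u (v # vs)" "\<And>u v. Z u v \<subseteq> ends u v"
  shows "xs \<noteq> []" "hd xs = (v, port v u)"
proof -
  have "xs \<noteq> [] \<and> hd xs = (v, port v u)"
  proof (cases vs)
    case Nil
    then obtain r where "xs = map (Pair v) r" "r \<in> ends u v" using assms by auto
    thus ?thesis by (auto simp: ends_def hd_map)
  next
    case (Cons v' vs')
    with assms(1) obtain r t where "xs = map (Pair v) r @ t" "r \<in> paths v (port v u) (port v v')"
      by (auto elim: lifts_ConsE)
    thus ?thesis using gadget_pathsD(1,2)[of r] by (auto simp: hd_append hd_map)
  qed
  thus "xs \<noteq> []" "hd xs = (v, port v u)" by auto
qed

lemma finite_lifts:
  assumes Z: "\<And>u v. Z u v \<subseteq> ends u v" and "set vs \<subseteq> V"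
  shows "finite (lifts Z u vs)"
  using assms(2)
proof (induction vs arbitrary: u rule: induct_list012)
  case (2 v)
  hence "finite (Z u v)"
    using finite_subset[OF subset_trans[OF Z ends_subset] finite_simple_lists] by simp
  thus ?case by simp
qed (auto intro!: finite_imageI finite_cartesian_product finite_paths)

text \<open>The block is the longest prefix lying over \<open>v\<close>, because \<open>t\<close>
  starts over another vertex; hence the cutting point is determined.\<close>

lemma append_block_inj:
  fixes v :: 'v and t t' :: "('v \<times> 'c) list"
  assumes "map (Pair v) r @ t = map (Pair v) r' @ t'" "t \<noteq> []" "t' \<noteq> []"
    "fst (hd t) \<noteq> v" "fst (hd t') \<noteq> v"
  shows "r = r' \<and> t = t'"
proof -
  have tw: "takeWhile (\<lambda>p. fst p = v) (map (Pair v) r @ t) = map (Pair v) r"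
    if "t \<noteq> []" "fst (hd t) \<noteq> v" for r and t :: "('v \<times> 'c) list"
    using that by (subst takeWhile_append2) (auto simp: takeWhile_eq_Nil_iff)
  have "map (Pair v) r = map (Pair v) r'"
    using tw[of t r] tw[of t' r'] assms by simp
  moreover have "inj (Pair v :: 'c \<Rightarrow> _)" by (auto intro: injI)
  ultimately have "r = r'" by (simp add: inj_map_eq_map)
  thus ?thesis using assms(1) by simp
qed

lemma sum_lifts:
  fixes x :: real and g :: "'v \<Rightarrow> real"
  assumes Z: "\<And>u v. Z u v \<subseteq> ends u v"
    and series: "\<And>v u u'. E v u \<Longrightarrow> E v u' \<Longrightarrow> u \<noteq> u' \<Longrightarrow>
      (\<Sum>r\<in>paths v (port v u) (port v u'). x ^ length r) = g v"
    and "successively E (u # v # vs)" "nonbacktracking (u # v # vs)"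
  shows "\<exists>a b. E a b \<and> (\<Sum>xs\<in>lifts Z u (v # vs). x ^ length xs) =
    prod_list (map g (butlast (v # vs))) * (\<Sum>r\<in>Z a b. x ^ length r)"
  using assms(3,4)
proof (induction vs arbitrary: u v)
  case Nil
  have "inj (map (Pair v) :: 'c list \<Rightarrow> _)" by (auto intro!: injI simp: inj_map_eq_map)
  hence "inj_on (map (Pair v)) (Z u v)" using inj_on_subset by blast
  thus ?case using Nil by (intro exI[of _ u] exI[of _ v]) (simp add: sum.reindex)
next
  case (Cons v' vs)
  have E: "E u v" "E v v'" "u \<noteq> v'" using Cons.prems by auto
  obtain a b where ab: "E a b" "(\<Sum>xs\<in>lifts Z v (v' # vs). x ^ length xs) =
      prod_list (map g (butlast (v' # vs))) * (\<Sum>r\<in>Z a b. x ^ length r)"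
    using Cons.IH[of v v'] Cons.prems by auto
  let ?P = "paths v (port v u) (port v v')"
  have "inj_on (\<lambda>(r, t). map (Pair v) r @ t) (?P \<times> lifts Z v (v' # vs))"
  proof (rule inj_onI, safe)
    fix r t r' t'
    assume eq: "map (Pair v) r @ t = map (Pair v) r' @ t'"
      and t: "t \<in> lifts Z v (v' # vs)" "t' \<in> lifts Z v (v' # vs)"
    have "v' \<noteq> v" using E edge_irrefl by auto
    hence "r = r' \<and> t = t'"
      using append_block_inj[OF eq] lifts_hd[OF t(1) Z] lifts_hd[OF t(2) Z] by simp
    thus "r = r'" "t = t'" by auto
  qed
  hence "(\<Sum>xs\<in>lifts Z u (v # v' # vs). x ^ length xs) =
      (\<Sum>(r, t)\<in>?P \<times> lifts Z v (v' # vs). x ^ length r * x ^ length t)"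
    unfolding lifts.simps by (subst sum.reindex) (auto simp: power_add intro!: sum.cong)
  also have "\<dots> = (\<Sum>r\<in>?P. x ^ length r) * (\<Sum>t\<in>lifts Z v (v' # vs). x ^ length t)"
    by (simp add: sum_product sum.cartesian_product)
  also have "\<dots> = g v * (\<Sum>t\<in>lifts Z v (v' # vs). x ^ length t)"
    using series[of v u v'] E edge_sym by simp
  finally show ?case using ab by auto
qed

text \<open>Without backtracking the entry and exit edges of a crossing are distinct; they lead to
  \<open>a\<close> and \<open>b\<close>. This prepares the port count for repeated
  crossings.\<close>

lemma lifts_two_ports:
  assumes "xs \<in> lifts Z u (v # vs)" "successively E (u # v # vs)" "nonbacktracking (u # v # vs)"
    "w \<in> set (butlast (v # vs))"
  shows "\<exists>a b. a \<noteq> b \<and> E w a \<and> E w b \<and> (w, port w a) \<in> set xs \<and> (w, port w b) \<in> set xs"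
  using assms
proof (induction vs arbitrary: u v xs)
  case (Cons v' vs)
  obtain r t where rt: "xs = map (Pair v) r @ t" "r \<in> paths v (port v u) (port v v')"
    "t \<in> lifts Z v (v' # vs)" using Cons.prems(1) by (rule lifts_ConsE)
  show ?case
  proof (cases "w = v")
    case True
    have "E v u" "E v v'" "u \<noteq> v'" using Cons.prems edge_sym by auto
    thus ?thesis using rt(1) gadget_pathsD(7,8)[OF rt(2)] True by auto
  next
    case False
    hence "\<exists>a b. a \<noteq> b \<and> E w a \<and> E w b \<and> (w, port w a) \<in> set t \<and> (w, port w b) \<in> set t"
      using Cons.prems by (intro Cons.IH[OF rt(3)]) auto
    thus ?thesis using rt(1) by auto
  qed
qed simp

text \<open>A self-avoiding lift crosses no gadget twice: two crossings would use four of its three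
  ports.\<close>

lemma lifts_distinct_route:
  assumes "xs \<in> lifts Z u (v # vs)" "\<And>u v. Z u v \<subseteq> ends u v" "successively E (u # v # vs)"
    "distinct ((u, port u v) # xs)"
  shows "nonbacktracking (u # v # vs) \<and> distinct (butlast (v # vs))"
  using assms(1,3,4)
proof (induction vs arbitrary: u v xs)
  case (Cons v' vs)
  obtain r t where rt: "xs = map (Pair v) r @ t" "r \<in> paths v (port v u) (port v v')"
    "t \<in> lifts Z v (v' # vs)" using Cons.prems(1) by (rule lifts_ConsE)
  note r = gadget_pathsD[OF rt(2)] and t = lifts_hd[OF rt(3) assms(2)]
  have E: "E v u" "E v v'" using Cons.prems edge_sym by auto
  have "(v, port v v') \<notin> set t" using r(8) Cons.prems(3) rt(1) by auto
  hence IH: "nonbacktracking (v # v' # vs)" "distinct (butlast (v' # vs))"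
    using Cons.IH[OF rt(3)] Cons.prems rt(1) by auto
  \<comment> \<open>Stepping back to \<open>u\<close> would re-enter its gadget at
    \<open>port u v\<close>, the very vertex by which it was left; that vertex is the extra head of
    the distinct list.\<close>
  have "(v', port v' v) \<in> set t" using t hd_in_set by metis
  hence "u \<noteq> v'" using Cons.prems(3) rt(1) by auto
  have "v \<notin> set (butlast (v' # vs))"
  proof
    assume v: "v \<in> set (butlast (v' # vs))"
    have "successively E (v # v' # vs)" using Cons.prems by simp
    from lifts_two_ports[OF rt(3) this IH(1) v] obtain a b where ab: "a \<noteq> b" "E v a" "E v b" "(v, port v a) \<in> set t" "(v, port v b) \<in> set t"
      by blast
    \<comment> \<open>The vertices of the present crossing do not recur in \<open>t\<close>, so the
      ports of the later crossing belong to edges other than those to \<open>u\<close> and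
      \<open>v'\<close>: four neighbours of \<open>v\<close>.\<close>
    have "(v, port v u) \<in> set (map (Pair v) r)" "(v, port v v') \<in> set (map (Pair v) r)"
      using r(7,8) by auto
    moreover have "set (map (Pair v) r) \<inter> set t = {}" using Cons.prems(3) rt(1) by auto
    ultimately have "a \<notin> {u, v'}" "b \<notin> {u, v'}" using ab by auto
    hence "card {u, v', a, b} = 4" using ab \<open>u \<noteq> v'\<close> by auto
    moreover have "card {u, v', a, b} \<le> card {w. E v w}"
      using E ab finite_neighbours edge_in by (intro card_mono) auto
    ultimately show False using degree_le[of v] edge_in E by fastforce
  qed
  thus ?case using IH \<open>u \<noteq> v'\<close> by simp
qed simp

text \<open>The block is the maximal prefix over \<open>v\<close>. What follows lies over another
  vertex, so the connecting step is an edge of the original graph and both of its ends are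
  ports.\<close>

lemma block_split:
  assumes xs: "successively ET xs" "distinct xs" "set xs \<subseteq> VT" "xs \<noteq> []" "fst (hd xs) = v"
  obtains r t where "xs = map (Pair v) r @ t" "r \<noteq> []" "set r \<subseteq> GV v" "distinct r" "successively GE r"
    "t \<noteq> [] \<Longrightarrow> \<exists>v'. hd t = (v', port v' v) \<and> last r = port v v' \<and> E v v'"
proof -
  define as where "as = takeWhile (\<lambda>p. fst p = v) xs"
  define t where "t = dropWhile (\<lambda>p. fst p = v) xs"
  define r where "r = map snd as"
  have eq: "xs = as @ t" by (simp add: as_def t_def)
  have fst_as: "fst p = v" if "p \<in> set as" for p using that set_takeWhileD by (fastforce simp: as_def)
  have as: "as = map (Pair v) r"
    unfolding r_def map_map by (rule map_idI[symmetric]) (use fst_as in \<open>auto simp: prod_eq_iff\<close>)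
  have "as \<noteq> []" unfolding as_def using xs(4,5) by (cases xs) auto
  hence "r \<noteq> []" by (simp add: r_def)
  have "successively ET (map (Pair v) r)" using xs(1) eq as by (simp add: successively_append_iff)
  hence "successively GE r"
    unfolding successively_map
    by (rule successively_mono) (use edge_irrefl in \<open>auto simp: ET_def\<close>)
  moreover have "set r \<subseteq> GV v" using xs(3) eq as by auto
  moreover have "distinct r" using xs(2) eq as by (auto simp: distinct_map)
  moreover have "\<exists>v'. hd t = (v', port v' v) \<and> last r = port v v' \<and> E v v'" if "t \<noteq> []"
  proof -
    have "fst (hd t) \<noteq> v" using that hd_dropWhile[of "\<lambda>p. fst p = v" xs] by (simp add: t_def)
    moreover have "ET (last as) (hd t)" using xs(1) eq \<open>as \<noteq> []\<close> that by (simp add: successively_append_iff)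
    moreover have "last as = (v, last r)" using as \<open>r \<noteq> []\<close> by (simp add: last_map)
    ultimately show ?thesis by (cases "hd t") (auto simp: ET_def)
  qed
  ultimately show ?thesis using that eq as \<open>r \<noteq> []\<close> by blast
qed

text \<open>Cutting off blocks repeatedly produces the route. Every visit to a gadget uses at least
  one vertex, whence the bound on \<open>length vs\<close>.\<close>

lemma saw_in_lifts:
  assumes "successively ET xs" "distinct xs" "set xs \<subseteq> VT" "xs \<noteq> []" "hd xs = (v, port v u)" "E u v"
  shows "\<exists>vs. length vs < length xs \<and> successively E (u # v # vs) \<and> xs \<in> lifts ends u (v # vs)"
  using assms
proof (induction xs arbitrary: u v rule: length_induct)
  case (1 xs)
  note prems = "1.prems"
  have "fst (hd xs) = v" using prems by simp
  then obtain r t where rt: "xs = map (Pair v) r @ t" "r \<noteq> []" "set r \<subseteq> GV v" "distinct r"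
      "successively GE r" "t \<noteq> [] \<Longrightarrow> \<exists>v'. hd t = (v', port v' v) \<and> last r = port v v' \<and> E v v'"
    using block_split[OF prems(1-4)] by metis
  have hd: "hd r = port v u" using prems(5) rt(1,2) by (simp add: hd_map)
  show ?case
  proof (cases "t = []")
    case True
    hence "xs \<in> lifts ends u [v]" using rt hd by (simp add: ends_def)
    thus ?thesis using prems by (intro exI[of _ "[]"]) auto
  next
    case False
    then obtain v' where v': "hd t = (v', port v' v)" "last r = port v v'" "E v v'" using rt(6) by blast
    have "\<exists>vs. length vs < length t \<and> successively E (v # v' # vs) \<and> t \<in> lifts ends v (v' # vs)"
      using "1.IH"[rule_format, of t v' v] prems rt(1,2) False v' by (auto simp: successively_append_iff)
    then obtain vs where vs: "length vs < length t" "successively E (v # v' # vs)"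
      "t \<in> lifts ends v (v' # vs)" by blast
    have "r \<in> paths v (port v u) (port v v')"
      using rt(2-5) hd v'(2) by (simp add: gadget_paths_def is_walk_successively)
    hence "xs \<in> lifts ends u (v # v' # vs)" using rt(1) vs(3) by (auto intro!: image_eqI[where x = "(r, t)"])
    thus ?thesis using vs rt(1,2) prems(6) by (intro exI[of _ "v' # vs"]) (cases r; auto)
  qed
qed

lemma prepend_block:
  assumes r: "r \<in> paths v c (port v v')" and E: "E v v'"
    and t: "t \<noteq> []" "hd t = (v', port v' v)" "successively ET t" "distinct t" "set t \<subseteq> VT"
    and v: "v \<notin> fst ` set t"
  shows "successively ET (map (Pair v) r @ t)" "distinct (map (Pair v) r @ t)"
    "set (map (Pair v) r @ t) \<subseteq> VT" "fst ` set (map (Pair v) r @ t) = insert v (fst ` set t)"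
    "remdups_adj (map fst (map (Pair v) r @ t)) = v # remdups_adj (map fst t)"
proof -
  note r = gadget_pathsD[OF r]
  have V: "v \<in> V" using E edge_in by auto
  have "successively (\<lambda>a b. ET (v, a) (v, b)) r"
    by (rule successively_mono[OF r(6)]) (use r(4) V in \<open>auto simp: ET_def\<close>)
  moreover have "ET (v, port v v') (v', port v' v)"
    using E edge_in edge_sym port_in by (auto simp: ET_def)
  ultimately show "successively ET (map (Pair v) r @ t)"
    using r(1,3) t by (simp add: successively_append_iff successively_map last_map)
  have "set (map (Pair v) r) \<inter> set t = {}" using v by force
  thus "distinct (map (Pair v) r @ t)" using r(5) t(4) by (auto simp: distinct_map inj_on_def)
  show "set (map (Pair v) r @ t) \<subseteq> VT" using t(5) r(4) V by auto
  show "fst ` set (map (Pair v) r @ t) = insert v (fst ` set t)"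
    using r(1) by (auto simp: image_Un image_image image_constant_conv)
  have "remdups_adj (map fst (map (Pair v) r @ t)) = remdups_adj (v # map fst t)"
    using remdups_adj_const_block[OF r(1), of v "map fst t"] by (simp add: comp_def)
  also have "\<dots> = v # remdups_adj (map fst t)"
    using t(1) v by (cases t) (auto simp: remdups_adj_Cons')
  finally show "remdups_adj (map fst (map (Pair v) r @ t)) = v # remdups_adj (map fst t)" .
qed

text \<open>Over a self-avoiding route the blocks lie in different gadgets, so every lift is
  self-avoiding. The last conjunct recovers the route, which keeps lifts of different routes
  apart.\<close>

lemma lifts_saw:
  assumes Z: "\<And>u v. Z u v \<subseteq> ends u v" and "xs \<in> lifts Z u (v # vs)" "successively E (u # v # vs)"
    "distinct (v # vs)"
  shows "successively ET xs \<and> distinct xs \<and> set xs \<subseteq> VT \<and> fst ` set xs = set (v # vs) \<and>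
    remdups_adj (map fst xs) = v # vs"
  using assms(2-)
proof (induction vs arbitrary: u v xs)
  case Nil
  then obtain r where r: "xs = map (Pair v) r" "r \<in> ends u v" using Z by auto
  have "v \<in> V" using Nil edge_in by auto
  have r': "r \<noteq> []" "set r \<subseteq> GV v" "distinct r" "successively GE r" using r(2) by (auto simp: ends_def)
  have "successively (\<lambda>a b. ET (v, a) (v, b)) r"
    by (rule successively_mono[OF r'(4)]) (use r'(2) \<open>v \<in> V\<close> in \<open>auto simp: ET_def\<close>)
  moreover have "remdups_adj (map fst xs) = [v]"
    using remdups_adj_const_block[OF r'(1), of v "[]"] by (simp add: r(1) comp_def)
  ultimately show ?case using r(1) r' \<open>v \<in> V\<close>
    by (auto simp: successively_map distinct_map inj_on_def image_image image_constant_conv)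
next
  case (Cons v' vs)
  obtain r t where rt: "xs = map (Pair v) r @ t" "r \<in> paths v (port v u) (port v v')"
    "t \<in> lifts Z v (v' # vs)" using Cons.prems(1) by (rule lifts_ConsE)
  have IH: "successively ET t" "distinct t" "set t \<subseteq> VT" "fst ` set t = set (v' # vs)"
    "remdups_adj (map fst t) = v' # vs"
    using Cons.IH[OF rt(3)] Cons.prems by auto
  have "E v v'" "v \<notin> fst ` set t" using Cons.prems IH(4) by auto
  from prepend_block[OF rt(2) this(1) lifts_hd[OF rt(3) Z] IH(1-3) this(2)]
  show ?case using IH by (simp add: rt(1))
qed

lemma lifts_length:
  assumes Z: "\<And>u v. Z u v \<subseteq> ends u v" and L: "\<And>v r. v \<in> V \<Longrightarrow> r \<in> simple_lists v \<Longrightarrow> length r \<le> L"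
    and "set vs \<subseteq> V" "xs \<in> lifts Z u vs"
  shows "length xs \<le> L * length vs"
  using assms(3,4)
proof (induction vs arbitrary: u xs rule: induct_list012)
  case (2 v)
  then obtain r where "xs = map (Pair v) r" "r \<in> Z u v" by auto
  thus ?case using L[of v r] Z ends_subset 2 by force
next
  case (3 v v' vs)
  obtain r t where rt: "xs = map (Pair v) r @ t" "r \<in> paths v (port v u) (port v v')"
    "t \<in> lifts Z v (v' # vs)" using 3(4) by (rule lifts_ConsE)
  have "length r \<le> L" using L[of v r] rt(2) paths_subset 3(3) by auto
  moreover have "length t \<le> L * length (v' # vs)" using 3(2)[OF _ rt(3)] 3(3) by simp
  ultimately show ?case using rt(1) by simp
qed simp

end

section \<open>Bounds for walk counts in the transformed graph by the weights of lifts\<close>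

lemma sum_le_sum_UN:
  fixes f :: "'a \<Rightarrow> real"
  assumes "finite I" "\<And>i. i \<in> I \<Longrightarrow> finite (B i)" "S \<subseteq> (\<Union>i\<in>I. B i)" "\<And>x. 0 \<le> f x"
  shows "sum f S \<le> (\<Sum>i\<in>I. sum f (B i))"
proof -
  have "sum f (\<Union>i\<in>I. B i) \<le> (\<Sum>i\<in>I. sum f (B i))"
    using assms(1,2)
  proof (induction I rule: finite_induct)
    case (insert i I)
    have "sum f (\<Union>j\<in>insert i I. B j) \<le> sum f (B i) + sum f (\<Union>j\<in>I. B j)"
    proof -
      have "sum f (B i \<union> (\<Union>j\<in>I. B j)) = sum f (B i) + sum f (\<Union>j\<in>I. B j) - sum f (B i \<inter> (\<Union>j\<in>I. B j))"
        using insert by (intro sum_Un) auto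
      moreover have "sum f (B i \<inter> (\<Union>j\<in>I. B j)) \<ge> 0" using assms(4) by (intro sum_nonneg) auto
      ultimately show ?thesis by simp
    qed
    thus ?case using insert by simp
  qed simp
  moreover have "sum f S \<le> sum f (\<Union>i\<in>I. B i)"
    using assms by (intro sum_mono2) auto
  ultimately show ?thesis by linarith
qed

context gadget_replacement
begin

lemma simple_lists_weight_bounded:
  fixes x :: real
  assumes "x \<ge> 0"
  obtains A where "A > 0" "\<And>v R. v \<in> V \<Longrightarrow> R \<subseteq> simple_lists v \<Longrightarrow> (\<Sum>r\<in>R. x ^ length r) \<le> A"
proof
  define w where "w S = (\<Sum>r | set r \<subseteq> S \<and> distinct r. x ^ length r)" for S :: "'c set"
  have w: "w S \<ge> 0" for S unfolding w_def using assms by (intro sum_nonneg) auto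
  show "1 + sum w (GV ` V) > 0" using w sum_nonneg[of "GV ` V" w] by auto
  fix v R assume v: "v \<in> V" and R: "R \<subseteq> simple_lists v"
  have "(\<Sum>r\<in>R. x ^ length r) \<le> w (GV v)"
    unfolding w_def using R finite_simple_lists[OF v] assms
    by (intro sum_mono2) (auto simp: simple_lists_def)
  also have "\<dots> \<le> sum w (GV ` V)"
    using v w finitely_many_gadgets by (intro member_le_sum) auto
  finally show "(\<Sum>r\<in>R. x ^ length r) \<le> 1 + sum w (GV ` V)" by simp
qed

lemma simple_lists_length_bounded:
  obtains L where "\<And>v r. v \<in> V \<Longrightarrow> r \<in> simple_lists v \<Longrightarrow> length r \<le> L"
proof
  fix v r assume "v \<in> V" "r \<in> simple_lists v"
  hence "length r \<le> card (GV v)"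
    using finite_gadget by (auto simp: simple_lists_def distinct_card[symmetric] intro!: card_mono)
  also have "\<dots> \<le> sum card (GV ` V)"
    using \<open>v \<in> V\<close> finitely_many_gadgets by (intro member_le_sum) auto
  finally show "length r \<le> sum card (GV ` V)" .
qed

text \<open>\<open>vs\<close> lists the gadgets after the initial one, and \<open>k\<close> is the
  number of crossings. Distinctness omits \<open>v\<close>, whose gadget may be crossed after the
  walk has left it, and the last gadget, which may have been crossed before.\<close>

definition routes :: "'v \<Rightarrow> nat \<Rightarrow> 'v list set" where
  "routes v k = {vs. length vs = Suc k \<and> successively E (v # vs) \<and> nonbacktracking (v # vs) \<and>
     distinct (butlast vs)}"

lemma finite_routes: "v \<in> V \<Longrightarrow> finite (routes v k)"
proof -
  assume v: "v \<in> V"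
  have "(#) v ` routes v k \<subseteq> {xs. length xs = Suc (Suc k) \<and> hd xs = v \<and> successively E xs}"
    by (auto simp: routes_def)
  hence "finite ((#) v ` routes v k)"
    by (rule finite_subset) (use v edge_in finite_neighbours in \<open>auto intro!: finite_walks[of E V]\<close>)
  thus ?thesis by (rule finite_imageD) (auto intro: inj_onI)
qed

text \<open>Without its last vertex, \<open>vs\<close> is a self-avoiding walk from a neighbour of
  \<open>v\<close>. The 9 is 3 choices of that neighbour times 3 of the last vertex.\<close>

lemma card_routes_le:
  assumes v: "v \<in> V" and "\<rho> \<ge> 1" "C \<ge> 1"
    and growth: "\<And>v n. v \<in> V \<Longrightarrow> real (saw_count E v n) \<le> C * \<rho> ^ n"
  shows "real (card (routes v k)) \<le> 9 * C * \<rho> ^ k"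
proof -
  let ?N = "\<lambda>v. {u. E v u}"
  show ?thesis
  proof (cases k)
    case 0
    have "routes v 0 \<subseteq> (\<lambda>u. [u]) ` ?N v" by (auto simp: routes_def length_Suc_conv)
    hence "card (routes v 0) \<le> card (?N v)"
      using finite_neighbours[OF v] by (meson card_image_le card_mono finite_imageI order_trans)
    thus ?thesis using degree_le[OF v] 0 assms(3) by simp
  next
    case (Suc j)
    let ?U = "\<Union>u\<in>?N v. saws_from E u j"
    let ?S = "SIGMA ws:?U. ?N (last ws)"
    have lastV: "last ws \<in> V" if "ws \<in> ?U" for ws
    proof -
      obtain u where u: "E v u" "ws \<in> saws_from E u j" using \<open>ws \<in> ?U\<close> by auto
      hence "set ws \<subseteq> V" "ws \<noteq> []" using saw_vertices[of u ws j] edge_in by (auto simp: mem_saws_from)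
      thus ?thesis by auto
    qed
    have finU: "finite ?U" using finite_neighbours[OF v] finite_saws_from edge_in by auto
    have finS: "finite ?S" using finU lastV finite_neighbours by (intro finite_SigmaI) auto
    have "routes v k \<subseteq> (\<lambda>(ws, y). ws @ [y]) ` ?S"
    proof
      fix vs assume vs: "vs \<in> routes v k"
      define ws y where "ws = butlast vs" and "y = last vs"
      have "vs \<noteq> []" using vs by (auto simp: routes_def)
      hence eq: "vs = ws @ [y]" by (simp add: ws_def y_def)
      have ws: "length ws = Suc j" "distinct ws" using vs Suc by (auto simp: routes_def ws_def)
      hence "ws \<noteq> []" by auto
      have "successively E (v # ws @ [y])" using vs eq by (simp add: routes_def)
      hence "E v (hd ws)" "successively E ws" "E (last ws) y"
        using \<open>ws \<noteq> []\<close> by (auto simp: successively_Cons successively_append_iff)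
      hence "(ws, y) \<in> ?S" using ws by (auto simp: mem_saws_from)
      thus "vs \<in> (\<lambda>(ws, y). ws @ [y]) ` ?S" using eq by force
    qed
    hence "card (routes v k) \<le> card ?S"
      using finS by (meson card_image_le card_mono finite_imageI order_trans)
    also have "card ?S = (\<Sum>ws\<in>?U. card (?N (last ws)))"
      using finU lastV finite_neighbours by (intro card_SigmaI) auto
    also have "\<dots> \<le> (\<Sum>ws\<in>?U. 3)" using lastV degree_le by (intro sum_mono) auto
    also have "\<dots> = 3 * card ?U" by simp
    also have "card ?U \<le> (\<Sum>u\<in>?N v. saw_count E u j)"
      unfolding saw_count_def using finite_neighbours[OF v] by (intro card_UN_le)
    finally have "real (card (routes v k)) \<le> 3 * (\<Sum>u\<in>?N v. real (saw_count E u j))"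
      by (simp flip: of_nat_sum)
    also have "(\<Sum>u\<in>?N v. real (saw_count E u j)) \<le> (\<Sum>u\<in>?N v. C * \<rho> ^ j)"
      using growth edge_in by (intro sum_mono) auto
    also have "\<dots> \<le> 3 * (C * \<rho> ^ k)"
    proof -
      have "C * \<rho> ^ j \<le> C * \<rho> ^ k" using assms(2,3) Suc by (intro mult_left_mono power_increasing) auto
      thus ?thesis using degree_le[OF v] assms(2,3) by (simp add: mult_mono)
    qed
    finally show ?thesis by simp
  qed
qed

text \<open>The initial block starts anywhere in its gadget and is not a crossing, so it is split
  off as an arbitrary simple list. Its final vertex is the exit port, which stands before
  \<open>t\<close> when distinctness of the route is derived.\<close>

lemma saws_from_subset_lifts:
  assumes p: "p \<in> VT"
  shows "saws_from ET p N \<subseteq> map (Pair (fst p)) ` simple_lists (fst p) \<union>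
    (\<Union>k<N. \<Union>vs\<in>routes (fst p) k.
      (\<lambda>(r, t). map (Pair (fst p)) r @ t) ` (simple_lists (fst p) \<times> lifts ends (fst p) vs))"
proof
  fix xs assume xs: "xs \<in> saws_from ET p N"
  define v where "v = fst p"
  have xs': "successively ET xs" "distinct xs" "set xs \<subseteq> VT" "xs \<noteq> []" "fst (hd xs) = v"
      "length xs = Suc N"
    using xs T.saw_vertices[OF p xs] by (auto simp: mem_saws_from v_def)
  obtain r t where rt: "xs = map (Pair v) r @ t" "r \<noteq> []" "set r \<subseteq> GV v" "distinct r"
      "successively GE r" "t \<noteq> [] \<Longrightarrow> \<exists>v'. hd t = (v', port v' v) \<and> last r = port v v' \<and> E v v'"
    using block_split[OF xs'(1-5)] by metis
  have r: "r \<in> simple_lists v" using rt by (simp add: simple_lists_def)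
  show "xs \<in> map (Pair (fst p)) ` simple_lists (fst p) \<union> (\<Union>k<N. \<Union>vs\<in>routes (fst p) k.
      (\<lambda>(r, t). map (Pair (fst p)) r @ t) ` (simple_lists (fst p) \<times> lifts ends (fst p) vs))"
  proof (cases "t = []")
    case True
    thus ?thesis using rt(1) r by (simp add: v_def)
  next
    case False
    then obtain v' where v': "hd t = (v', port v' v)" "last r = port v v'" "E v v'" using rt(6) by blast
    have t: "successively ET t" "distinct t" "set t \<subseteq> VT" "length t \<le> N"
      using xs' rt(1,2) by (auto simp: successively_append_iff neq_Nil_conv)
    obtain vs where vs: "length vs < length t" "successively E (v # v' # vs)" "t \<in> lifts ends v (v' # vs)"
      using saw_in_lifts[OF t(1-3) False v'(1,3)] by blast
    have "(v, port v v') \<in> set (map (Pair v) r)" using rt(2) v'(2) last_in_set by fastforce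
    hence "distinct ((v, port v v') # t)" using xs'(2) rt(1) by auto
    hence "nonbacktracking (v # v' # vs) \<and> distinct (butlast (v' # vs))"
      by (intro lifts_distinct_route[OF vs(3) _ vs(2)]) auto
    hence "v' # vs \<in> routes v (length vs)" using vs(2) by (simp add: routes_def)
    moreover have "length vs < N" using vs(1) t(4) by simp
    moreover have "xs \<in> (\<lambda>(r, t). map (Pair v) r @ t) ` (simple_lists v \<times> lifts ends v (v' # vs))"
      using rt(1) r vs(3) by (intro image_eqI[where x = "(r, t)"]) simp_all
    ultimately show ?thesis unfolding v_def[symmetric] by blast
  qed
qed

text \<open>Up to constants there are at most \<open>\<rho> ^ k\<close> routes with \<open>k\<close>
  crossings, and the lifts of each weigh at most \<open>y ^ k\<close>. For
  \<open>\<rho> * y < 1\<close> the geometric series bounds the total weight independently of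
  \<open>N\<close> and \<open>p\<close>.\<close>

lemma lifted_saw_count_upper:
  fixes x y \<rho> C K :: real and g :: "'v \<Rightarrow> real"
  assumes x: "x > 0" and \<rho>: "\<rho> \<ge> 1" and C: "C \<ge> 1" and K: "K \<ge> 0" and y: "y \<ge> 0" and \<rho>y: "\<rho> * y < 1"
    and growth: "\<And>v n. v \<in> V \<Longrightarrow> real (saw_count E v n) \<le> C * \<rho> ^ n"
    and series: "\<And>v u u'. E v u \<Longrightarrow> E v u' \<Longrightarrow> u \<noteq> u' \<Longrightarrow>
      (\<Sum>r\<in>paths v (port v u) (port v u'). x ^ length r) = g v"
    and g: "\<And>v. v \<in> V \<Longrightarrow> g v \<ge> 0"
    and prod_le: "\<And>ws. successively E ws \<Longrightarrow> set ws \<subseteq> V \<Longrightarrow> prod_list (map g ws) \<le> K * y ^ length ws"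
  shows "\<exists>B>0. \<forall>p\<in>VT. \<forall>N. real (saw_count ET p N) * x ^ N \<le> B"
proof -
  obtain A where A: "A > 0" "\<And>v R. v \<in> V \<Longrightarrow> R \<subseteq> simple_lists v \<Longrightarrow> (\<Sum>r\<in>R. x ^ length r) \<le> A"
    using simple_lists_weight_bounded[of x] x by auto
  \<comment> \<open>Walks inside the initial gadget weigh at most \<open>A\<close>. Otherwise the
    initial block and the final segment contribute a factor \<open>A\<close> each, the number of
    routes \<open>9 * C\<close>, and the products along them \<open>K\<close>.\<close>
  define B where "B = A + A * (9 * C * K * A) / (1 - \<rho> * y)"
  have "B > 0" unfolding B_def using A C K \<rho>y by (intro add_pos_nonneg divide_nonneg_pos) auto
  \<comment> \<open>Weights count vertices, one more than steps, hence the division by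
    \<open>x\<close>.\<close>
  have "real (saw_count ET p N) * x ^ N \<le> B / x" if p: "p \<in> VT" for p N
  proof -
    define v where "v = fst p"
    have v: "v \<in> V" using p by (auto simp: v_def)
    let ?f = "\<lambda>xs :: ('v \<times> 'c) list. x ^ length xs"
    let ?D = "\<lambda>vs. (\<lambda>(r, t). map (Pair v) r @ t) ` (simple_lists v \<times> lifts ends v vs)"
    let ?U = "\<Union>k<N. \<Union>vs\<in>routes v k. ?D vs"
    have routesV: "set vs \<subseteq> V" if "vs \<in> routes v k" for vs k
      using that walk_vertices[of E V "v # vs"] edge_in v by (auto simp: routes_def)
    have finD: "finite (?D vs)" if "vs \<in> routes v k" for vs k
      using routesV[OF that] finite_lifts[of ends vs v] finite_simple_lists[OF v] by auto
    have D: "sum ?f (?D vs) \<le> A * (K * A * y ^ k)" if vs: "vs \<in> routes v k" for vs k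
    proof -
      obtain v' vs' where eq: "vs = v' # vs'" using vs by (cases vs) (auto simp: routes_def)
      have vs': "successively E (v # v' # vs')" "nonbacktracking (v # v' # vs')" "length (butlast vs) = k"
        using vs by (auto simp: routes_def eq)
      have "\<exists>a b. E a b \<and> (\<Sum>xs\<in>lifts ends v (v' # vs'). x ^ length xs) =
        prod_list (map g (butlast (v' # vs'))) * (\<Sum>r\<in>ends a b. x ^ length r)"
        using series vs' by (intro sum_lifts) auto
      then obtain a b where ab: "E a b" "sum ?f (lifts ends v vs) =
          prod_list (map g (butlast vs)) * (\<Sum>r\<in>ends a b. x ^ length r)" unfolding eq by blast
      have sb: "set (butlast vs) \<subseteq> V" using routesV[OF vs] by (auto dest: in_set_butlastD)
      have "successively E vs" using vs' by (simp add: eq)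
      hence "successively E (butlast vs @ [last vs])" by (simp add: eq)
      hence "successively E (butlast vs)" by (simp only: successively_append_iff)
      hence P: "prod_list (map g (butlast vs)) \<le> K * y ^ k"
        using prod_le[of "butlast vs"] sb vs'(3) by simp
      have P0: "prod_list (map g (butlast vs)) \<ge> 0" using sb g by (intro prod_list_nonneg) auto
      have "(\<Sum>r\<in>ends a b. x ^ length r) \<le> A" using A(2)[of b "ends a b"] ends_subset ab(1) edge_in by auto
      hence lift: "sum ?f (lifts ends v vs) \<le> K * y ^ k * A"
        unfolding ab(2) using P P0 A(1) x by (intro mult_mono) (auto intro!: sum_nonneg)
      have "sum ?f (?D vs) \<le> sum (?f \<circ> (\<lambda>(r, t). map (Pair v) r @ t)) (simple_lists v \<times> lifts ends v vs)"
        using finite_lifts[of ends vs v] routesV[OF vs] finite_simple_lists[OF v] x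
        by (intro sum_image_le) auto
      also have "\<dots> = (\<Sum>(r, t)\<in>simple_lists v \<times> lifts ends v vs. x ^ length r * x ^ length t)"
        by (intro sum.cong) (auto simp: power_add)
      also have "\<dots> = (\<Sum>r\<in>simple_lists v. x ^ length r) * sum ?f (lifts ends v vs)"
        by (simp add: sum_product sum.cartesian_product)
      also have "\<dots> \<le> A * (K * y ^ k * A)"
        using A v lift x by (intro mult_mono) (auto intro!: sum_nonneg)
      finally show ?thesis by (simp add: mult_ac)
    qed
    have finU: "finite ?U" using finD finite_routes[OF v] by blast
    have routes_sum: "sum ?f (\<Union>vs\<in>routes v k. ?D vs) \<le> A * (9 * C * K * A) * (\<rho> * y) ^ k" for k
    proof -
      have "sum ?f (\<Union>vs\<in>routes v k. ?D vs) \<le> (\<Sum>vs\<in>routes v k. sum ?f (?D vs))"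
        using finD finite_routes[OF v] x by (intro sum_le_sum_UN) auto
      also have "\<dots> \<le> (\<Sum>vs\<in>routes v k. A * (K * A * y ^ k))" by (intro sum_mono D)
      also have "\<dots> = real (card (routes v k)) * (A * (K * A * y ^ k))" by simp
      also have "\<dots> \<le> 9 * C * \<rho> ^ k * (A * (K * A * y ^ k))"
        using card_routes_le[OF v \<rho> C growth, of k] A K y by (intro mult_right_mono) auto
      finally show ?thesis by (simp add: power_mult_distrib mult_ac)
    qed
    have "real (saw_count ET p N) * x ^ Suc N = (\<Sum>xs\<in>saws_from ET p N. x ^ Suc N)"
      by (simp add: saw_count_def)
    also have "\<dots> = sum ?f (saws_from ET p N)" by (intro sum.cong) (auto simp: mem_saws_from)
    also have "\<dots> \<le> sum ?f (map (Pair v) ` simple_lists v \<union> ?U)"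
      using saws_from_subset_lifts[OF p, of N] finU finite_simple_lists[OF v] x
      unfolding v_def[symmetric] by (intro sum_mono2) auto
    also have "\<dots> \<le> sum ?f (map (Pair v) ` simple_lists v) + sum ?f ?U"
    proof -
      have "sum ?f (map (Pair v) ` simple_lists v \<union> ?U) = sum ?f (map (Pair v) ` simple_lists v)
          + sum ?f ?U - sum ?f (map (Pair v) ` simple_lists v \<inter> ?U)"
        using finU finite_simple_lists[OF v] by (intro sum_Un) auto
      moreover have "sum ?f (map (Pair v) ` simple_lists v \<inter> ?U) \<ge> 0"
        using x by (intro sum_nonneg) auto
      ultimately show ?thesis by linarith
    qed
    also have "sum ?f (map (Pair v) ` simple_lists v) \<le> A"
    proof -
      have "sum ?f (map (Pair v) ` simple_lists v) \<le> sum (?f \<circ> map (Pair v)) (simple_lists v)"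
        using finite_simple_lists[OF v] x by (intro sum_image_le) auto
      also have "\<dots> \<le> A" using A(2)[OF v order_refl] by (simp add: comp_def)
      finally show ?thesis .
    qed
    also have "sum ?f ?U \<le> (\<Sum>k<N. sum ?f (\<Union>vs\<in>routes v k. ?D vs))"
    proof (rule sum_le_sum_UN)
      show "finite (\<Union>vs\<in>routes v k. ?D vs)" for k using finD finite_routes[OF v] by blast
    qed (use x in auto)
    also have "\<dots> \<le> (\<Sum>k<N. A * (9 * C * K * A) * (\<rho> * y) ^ k)" by (intro sum_mono routes_sum)
    also have "\<dots> = A * (9 * C * K * A) * (\<Sum>k<N. (\<rho> * y) ^ k)" by (simp add: sum_distrib_left)
    also have "\<dots> \<le> A * (9 * C * K * A) * (1 / (1 - \<rho> * y))"
    proof (intro mult_left_mono)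
      have "(\<Sum>k<N. (\<rho> * y) ^ k) = (1 - (\<rho> * y) ^ N) / (1 - \<rho> * y)"
        using \<rho>y by (simp add: sum_gp_strict)
      also have "\<dots> \<le> 1 / (1 - \<rho> * y)" using \<rho>y \<rho> y by (intro divide_right_mono) auto
      finally show "(\<Sum>k<N. (\<rho> * y) ^ k) \<le> 1 / (1 - \<rho> * y)" .
    qed (use A C K in auto)
    finally have "real (saw_count ET p N) * x ^ Suc N \<le> B" by (simp add: B_def)
    thus ?thesis using x by (simp add: field_simps)
  qed
  moreover have "B / x > 0" using \<open>B > 0\<close> x by simp
  ultimately show ?thesis by blast
qed

text \<open>Distinct self-avoiding walks have distinct self-avoiding lifts, so the weight of these
  lifts bounds the counts from below. The length of a lift is only known to lie in a window, whence
  the sum over \<open>K\<close>.\<close>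

lemma lifted_saw_count_lower:
  fixes x y \<kappa> :: real and g :: "'v \<Rightarrow> real"
  assumes x: "x > 0" and y: "y > 0" and \<kappa>: "\<kappa> > 0" and p: "p \<in> VT"
    and series: "\<And>v u u'. E v u \<Longrightarrow> E v u' \<Longrightarrow> u \<noteq> u' \<Longrightarrow>
      (\<Sum>r\<in>paths v (port v u) (port v u'). x ^ length r) = g v"
    and prod_ge: "\<And>ws. successively E ws \<Longrightarrow> set ws \<subseteq> V \<Longrightarrow> \<kappa> * y ^ length ws \<le> prod_list (map g ws)"
  shows "\<exists>L. \<exists>c>0. \<forall>m\<ge>1. c * real (saw_count E (fst p) m) * y ^ m \<le>
    (\<Sum>K=m..L * (m + 1). real (saw_count ET p K) * x ^ K)"
proof -
  obtain v a where va: "p = (v, a)" "v \<in> V" "a \<in> GV v" using p by auto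
  obtain L where L: "\<And>v r. v \<in> V \<Longrightarrow> r \<in> simple_lists v \<Longrightarrow> length r \<le> L"
    using simple_lists_length_bounded by blast
  \<comment> \<open>The lift stops at the port by which it enters the last gadget, so its last
    factor is exactly \<open>x\<close>.\<close>
  define Z where "Z u v = (if E v u then {[port v u]} else {})" for u v
  have Z: "Z u v \<subseteq> ends u v" for u v using port_in by (auto simp: Z_def ends_def)
  have "\<forall>u. E v u \<longrightarrow> (\<exists>r. r \<in> paths v a (port v u))"
    using gadget_connected[OF va(2,3)] port_in by blast
  then obtain q where q: "\<And>u. E v u \<Longrightarrow> q u \<in> paths v a (port v u)" by metis
  \<comment> \<open>The prefix \<open>q\<close> inside the initial gadget has at most
    \<open>L\<close> vertices and weighs at least \<open>min 1 x ^ L\<close>. The constant \<kappa>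
    belongs to the product over the \<open>m - 1\<close> crossed gadgets, and the division by
    \<open>y\<close> turns \<open>y ^ (m - 1)\<close> into \<open>y ^ m\<close>.\<close>
  define c where "c = min 1 x ^ L * \<kappa> / y"
  have "c > 0" using x y \<kappa> by (simp add: c_def)
  have "c * real (saw_count E v m) * y ^ m \<le> (\<Sum>K=m..L * (m + 1). real (saw_count ET p K) * x ^ K)"
    if m: "m \<ge> 1" for m
  proof -
    let ?f = "\<lambda>xs :: ('v \<times> 'c) list. x ^ length xs"
    define R where "R = {vs. v # vs \<in> saws_from E v m}"
    define low where "low vs = (\<lambda>t. map (Pair v) (q (hd vs)) @ t) ` lifts Z v vs" for vs
    have sR: "saws_from E v m = (#) v ` R"
    proof safe
      fix xs assume "xs \<in> saws_from E v m"
      thus "xs \<in> (#) v ` R" by (cases xs) (auto simp: R_def mem_saws_from)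
    qed (auto simp: R_def)
    have cR: "card R = saw_count E v m" unfolding saw_count_def sR by (simp add: card_image)
    have finR: "finite R"
      using finite_saws_from[OF va(2), of m] unfolding sR by (rule finite_imageD) (auto intro: inj_onI)
    have R: "length vs = m" "vs \<noteq> []" "distinct (v # vs)" "successively E (v # vs)" "E v (hd vs)"
        "set vs \<subseteq> V" "nonbacktracking (v # vs)" if "vs \<in> R" for vs
    proof -
      show *: "length vs = m" "vs \<noteq> []" "distinct (v # vs)" "successively E (v # vs)"
        using that m by (auto simp: R_def mem_saws_from)
      show "E v (hd vs)" using *(2,4) by (simp add: successively_Cons)
      show "set vs \<subseteq> V" using walk_vertices[of E V "v # vs"] *(4) edge_in va(2) by auto
      show "nonbacktracking (v # vs)" using *(3) by (rule nonbacktracking_of_distinct)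
    qed
    have low: "remdups_adj (map fst xs) = v # vs" "\<exists>K\<in>{m..L * (m + 1)}. xs \<in> saws_from ET p K"
      if vs: "vs \<in> R" and xs: "xs \<in> low vs" for vs xs
    proof -
      obtain v' vs' where eq: "vs = v' # vs'" using R(2)[OF vs] by (cases vs) auto
      obtain t where t: "xs = map (Pair v) (q v') @ t" "t \<in> lifts Z v (v' # vs')"
        using xs by (auto simp: low_def eq)
      have e: "E v v'" and d: "distinct (v # v' # vs')" and s: "successively E (v # v' # vs')"
        using R[OF vs] by (auto simp: eq)
      have T: "successively ET t" "distinct t" "set t \<subseteq> VT" "fst ` set t = set (v' # vs')"
          "remdups_adj (map fst t) = v' # vs'"
        using lifts_saw[OF Z t(2) s] d by auto
      have "v \<notin> fst ` set t" using T(4) d by auto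
      note b = prepend_block[OF q[OF e] e lifts_hd[OF t(2) Z] T(1-3) this]
      show rem: "remdups_adj (map fst xs) = v # vs" using b(5) T(5) by (simp add: t(1) eq)
      have qp: "q v' \<noteq> []" "hd (q v') = a" "q v' \<in> simple_lists v"
        using gadget_pathsD(1,2)[OF q[OF e]] paths_subset q[OF e] by auto
      have "hd xs = p" "xs \<noteq> []" using qp va(1) by (auto simp: t(1) hd_map)
      have "m + 1 = length (v # vs)" using R(1)[OF vs] by simp
      also have "\<dots> = length (remdups_adj (map fst xs))" by (simp only: rem)
      also have "\<dots> \<le> length xs" using remdups_adj_length[of "map fst xs"] by simp
      finally have 1: "m + 1 \<le> length xs" .
      have "length t \<le> L * length vs"
        using lifts_length[OF Z L _ t(2)] R(6)[OF vs] by (simp add: eq)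
      hence 2: "length xs \<le> L * (m + 1)"
        using L[OF va(2) qp(3)] R(1)[OF vs] by (simp add: t(1))
      have "xs \<in> saws_from ET p (length xs - 1)"
        using b(1,2) \<open>hd xs = p\<close> \<open>xs \<noteq> []\<close> by (simp add: mem_saws_from t(1))
      thus "\<exists>K\<in>{m..L * (m + 1)}. xs \<in> saws_from ET p K"
        using 1 2 by (intro bexI[of _ "length xs - 1"]) auto
    qed
    have fin_low: "finite (low vs)" if "vs \<in> R" for vs
      unfolding low_def using finite_lifts[of Z vs v] Z R(6)[OF that] by auto
    have low_sum: "min 1 x ^ L * \<kappa> * y ^ (m - 1) * x \<le> sum ?f (low vs)" if vs: "vs \<in> R" for vs
    proof -
      obtain v' vs' where eq: "vs = v' # vs'" using R(2)[OF vs] by (cases vs) auto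
      have "\<exists>a b. E a b \<and> (\<Sum>xs\<in>lifts Z v (v' # vs'). x ^ length xs) =
        prod_list (map g (butlast (v' # vs'))) * (\<Sum>r\<in>Z a b. x ^ length r)"
        using series R[OF vs] Z by (intro sum_lifts) (auto simp: eq)
      then obtain a b where ab: "E a b" "sum ?f (lifts Z v vs) =
          prod_list (map g (butlast vs)) * (\<Sum>r\<in>Z a b. x ^ length r)" unfolding eq by blast
      have Zab: "(\<Sum>r\<in>Z a b. x ^ length r) = x" using edge_sym[OF ab(1)] by (simp add: Z_def)
      have sb: "set (butlast vs) \<subseteq> V" using R(6)[OF vs] by (auto dest: in_set_butlastD)
      have "successively E vs" using R(4)[OF vs] by (simp add: eq)
      hence "successively E (butlast vs @ [last vs])" by (simp add: eq)
      hence "successively E (butlast vs)" by (simp only: successively_append_iff)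
      hence P: "\<kappa> * y ^ (m - 1) \<le> prod_list (map g (butlast vs))"
        using prod_ge[of "butlast vs"] sb R(1)[OF vs] by simp
      have "q v' \<in> simple_lists v" using q[of v'] paths_subset R(5)[OF vs] by (auto simp: eq)
      hence "length (q v') \<le> L" using L va(2) by blast
      hence "min 1 x ^ L \<le> min 1 x ^ length (q v')" using x by (intro power_decreasing) auto
      also have "\<dots> \<le> x ^ length (q v')" using x by (intro power_mono) auto
      finally have Q: "min 1 x ^ L \<le> x ^ length (q v')" .
      have "sum ?f (low vs) = (\<Sum>t\<in>lifts Z v vs. x ^ length (q v') * x ^ length t)"
        unfolding low_def by (subst sum.reindex) (auto simp: inj_on_def power_add eq)
      also have "\<dots> = x ^ length (q v') * (prod_list (map g (butlast vs)) * x)"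
        by (simp add: sum_distrib_left[symmetric] ab(2) Zab)
      also have "\<dots> \<ge> min 1 x ^ L * (\<kappa> * y ^ (m - 1) * x)"
        using Q P x y \<kappa> by (intro mult_mono mult_right_mono) auto
      finally show ?thesis by (simp add: mult_ac)
    qed
    \<comment> \<open>The additional \<open>x\<close> is the weight of the final port; it cancels
      against the offset between \<open>K\<close> steps and \<open>K + 1\<close> vertices.\<close>
    have "(c * real (saw_count E v m) * y ^ m) * x = (\<Sum>vs\<in>R. min 1 x ^ L * \<kappa> * y ^ (m - 1) * x)"
      using y m by (simp add: cR c_def power_eq_if)
    also have "\<dots> \<le> (\<Sum>vs\<in>R. sum ?f (low vs))" by (intro sum_mono low_sum)
    also have "\<dots> = sum ?f (\<Union>vs\<in>R. low vs)"
    proof (rule sum.UNION_disjoint[symmetric])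
      show "\<forall>vs\<in>R. \<forall>vs'\<in>R. vs \<noteq> vs' \<longrightarrow> low vs \<inter> low vs' = {}"
        using low(1) by (metis (no_types) disjoint_iff list.inject)
    qed (use finR fin_low in auto)
    also have "\<dots> \<le> sum ?f (\<Union>K\<in>{m..L * (m + 1)}. saws_from ET p K)"
      using low(2) T.finite_saws_from[OF p] x by (intro sum_mono2) auto
    also have "\<dots> = (\<Sum>K=m..L * (m + 1). sum ?f (saws_from ET p K))"
      using T.finite_saws_from[OF p] by (intro sum.UNION_disjoint) (auto simp: mem_saws_from)
    also have "\<dots> = (\<Sum>K=m..L * (m + 1). real (saw_count ET p K) * x ^ K * x)"
    proof (rule sum.cong)
      fix K
      have "sum ?f (saws_from ET p K) = (\<Sum>xs\<in>saws_from ET p K. x ^ Suc K)"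
        by (intro sum.cong) (auto simp: mem_saws_from)
      thus "sum ?f (saws_from ET p K) = real (saw_count ET p K) * x ^ K * x" by (simp add: saw_count_def)
    qed simp
    also have "\<dots> = (\<Sum>K=m..L * (m + 1). real (saw_count ET p K) * x ^ K) * x"
      by (simp add: sum_distrib_right)
    finally show ?thesis using x by simp
  qed
  with \<open>c > 0\<close> show ?thesis unfolding va(1) fst_conv by blast
qed

end

section \<open>The critical point of the transformed graph\<close>

context gadget_replacement
begin

text \<open>\<open>Y x\<close> is the mean weight of a crossing. Below \<open>x0\<close> it is less
  than \<open>1 / \<mu>\<close>, so the generating function stays bounded; at \<open>x0\<close> it
  balances \<mu> exactly, so the weight of the lifts decays no faster than any prescribed
  \<open>l ^ m\<close> with \<open>l < 1\<close>, up to a constant.\<close>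

theorem root_lifted_saw_count_tendsto:
  fixes g :: "'v \<Rightarrow> real \<Rightarrow> real" and Y :: "real \<Rightarrow> real" and x0 \<mu> :: real
  assumes \<mu>: "\<mu> \<ge> 1"
    and upper: "\<And>\<rho>. \<mu> < \<rho> \<Longrightarrow> \<exists>C>0. \<forall>v\<in>V. \<forall>n. real (saw_count E v n) \<le> C * \<rho> ^ n"
    and lower: "\<And>v \<rho>. v \<in> V \<Longrightarrow> 0 < \<rho> \<Longrightarrow> \<rho> < \<mu> \<Longrightarrow> \<exists>c>0. \<forall>n. c * \<rho> ^ n \<le> real (saw_count E v n)"
    and series: "\<And>x v u u'. E v u \<Longrightarrow> E v u' \<Longrightarrow> u \<noteq> u' \<Longrightarrow>
      (\<Sum>r\<in>paths v (port v u) (port v u'). x ^ length r) = g v x"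
    and g_pos: "\<And>v x. v \<in> V \<Longrightarrow> x > 0 \<Longrightarrow> g v x > 0"
    and prods: "\<And>x. x > 0 \<Longrightarrow> \<exists>K \<kappa>. K \<ge> 0 \<and> \<kappa> > 0 \<and> (\<forall>ws. successively E ws \<longrightarrow> set ws \<subseteq> V \<longrightarrow>
      \<kappa> * Y x ^ length ws \<le> (\<Prod>w\<leftarrow>ws. g w x) \<and> (\<Prod>w\<leftarrow>ws. g w x) \<le> K * Y x ^ length ws)"
    and Y_pos: "\<And>x. x > 0 \<Longrightarrow> Y x > 0" and Y_less: "\<And>x. 0 < x \<Longrightarrow> x < x0 \<Longrightarrow> Y x < Y x0"
    and x0: "x0 > 0" "Y x0 = 1 / \<mu>" and p: "p \<in> VT"
  shows "(\<lambda>n. root n (real (saw_count ET p n))) \<longlonglongrightarrow> 1 / x0"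
proof -
  define s where "s n = real (saw_count ET p n)" for n
  have unif: "\<exists>B>0. \<forall>p\<in>VT. \<forall>n. real (saw_count ET p n) \<le> B * \<rho> ^ n" if \<rho>: "1 / x0 < \<rho>" for \<rho>
  proof -
    define x where "x = 1 / \<rho>"
    have "\<rho> > 0" using \<rho> x0(1) less_trans[of 0 "1 / x0" \<rho>] by simp
    hence x: "x > 0" "x < x0" using \<rho> x0(1) by (auto simp: x_def field_simps)
    have "Y x < 1 / \<mu>" using Y_less[OF x] x0(2) by simp
    hence Y: "0 < Y x" "\<mu> < 1 / Y x" using Y_pos[OF x(1)] \<mu> by (auto simp: field_simps)
    \<comment> \<open>The growth bound is available strictly above \<mu>, so some room below
      \<open>1 / Y x\<close> is used up here.\<close>
    then obtain \<rho>' where \<rho>': "\<mu> < \<rho>'" "\<rho>' < 1 / Y x" using dense by blast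
    obtain C where C: "C > 0" "\<And>v n. v \<in> V \<Longrightarrow> real (saw_count E v n) \<le> C * \<rho>' ^ n"
      using upper[OF \<rho>'(1)] by blast
    have "real (saw_count E v n) \<le> max 1 C * \<rho>' ^ n" if "v \<in> V" for v n
      by (rule order_trans[OF C(2)[OF that]]) (use \<rho>'(1) \<mu> in \<open>auto intro!: mult_right_mono\<close>)
    moreover obtain K \<kappa> where "K \<ge> 0" "\<And>ws. successively E ws \<Longrightarrow> set ws \<subseteq> V \<Longrightarrow>
        (\<Prod>w\<leftarrow>ws. g w x) \<le> K * Y x ^ length ws"
      using prods[OF x(1)] by blast
    moreover have "\<rho>' * Y x < 1" using \<rho>' Y by (simp add: field_simps)
    ultimately have "\<exists>B>0. \<forall>p\<in>VT. \<forall>n. real (saw_count ET p n) * x ^ n \<le> B"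
      using x(1) \<rho>'(1) \<mu> Y(1) g_pos
      by (intro lifted_saw_count_upper[of x \<rho>' "max 1 C" K "Y x" "\<lambda>v. g v x"] series)
         (auto intro: less_imp_le)
    then obtain B where B: "B > 0" "\<And>p n. p \<in> VT \<Longrightarrow> real (saw_count ET p n) * x ^ n \<le> B" by blast
    have "real (saw_count ET p n) \<le> B * \<rho> ^ n" if "p \<in> VT" for p n
      using B(2)[OF that, of n] \<open>\<rho> > 0\<close> by (simp add: x_def power_divide field_simps)
    with B(1) show ?thesis by blast
  qed
  have sub: "\<exists>C>0. \<forall>m n. s (m + n) \<le> s m * (C * \<rho> ^ n)" if \<rho>: "1 / x0 < \<rho>" for \<rho>
  proof -
    obtain B where "B > 0" "\<And>p n. p \<in> VT \<Longrightarrow> real (saw_count ET p n) \<le> B * \<rho> ^ n"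
      using unif[OF \<rho>] by blast
    thus ?thesis unfolding s_def using T.saw_count_add_le[OF p] by blast
  qed
  have fp: "fst p \<in> V" using p by auto
  obtain K \<kappa> where \<kappa>: "\<kappa> > 0" "\<And>ws. successively E ws \<Longrightarrow> set ws \<subseteq> V \<Longrightarrow>
      \<kappa> * Y x0 ^ length ws \<le> (\<Prod>w\<leftarrow>ws. g w x0)"
    using prods[OF x0(1)] by blast
  obtain L c where Lc: "c > 0" "\<And>m. m \<ge> 1 \<Longrightarrow> c * real (saw_count E (fst p) m) * Y x0 ^ m \<le>
      (\<Sum>K=m..L * (m + 1). real (saw_count ET p K) * x0 ^ K)"
    using lifted_saw_count_lower[where g = "\<lambda>v. g v x0", OF x0(1) Y_pos[OF x0(1)] \<kappa>(1) p series \<kappa>(2)]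
    by blast
  \<comment> \<open>Of the two powers of \<open>l\<close>, one is the deficit of the lower bound
    with base \<open>l * \<mu>\<close>, and the other absorbs the size of the window over which the
    average is taken.\<close>
  have sparse: "\<exists>c>0. \<forall>n. \<exists>K\<ge>n. K \<le> (2 * L) * (n + 1) \<and> c * ((1 / x0) ^ K * l ^ (2 * K)) \<le> s K"
    if l: "0 < l" "l < 1" for l
  proof -
    have "0 < l * \<mu>" "l * \<mu> < \<mu>" using l \<mu> by auto
    then obtain c1 where c1: "c1 > 0" "\<And>n. c1 * (l * \<mu>) ^ n \<le> real (saw_count E (fst p) n)"
      using lower[OF fp] by blast
    obtain b0 where b0: "b0 > 0" "\<And>n. b0 * (real n + 1) * l ^ n \<le> 1"
      using linear_times_geometric_bounded[OF l] by blast
    define c2 where "c2 = c * c1 * b0 / (real L + 1)"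
    have "c2 > 0" using Lc(1) c1(1) b0(1) by (simp add: c2_def)
    have "\<exists>K\<ge>n. K \<le> (2 * L) * (n + 1) \<and> c2 * ((1 / x0) ^ K * l ^ (2 * K)) \<le> s K" for n
    proof -
      \<comment> \<open>The bound \<open>Lc\<close> requires a positive length. The window then ends
        at \<open>L * (n + 2)\<close>, which explains \<open>2 * L\<close>.\<close>
      define m where "m = Suc n"
      let ?A = "{m..L * (m + 1)}"
      have "c * c1 * l ^ m = c * (c1 * (l * \<mu>) ^ m) * Y x0 ^ m"
        using x0(2) \<mu> by (simp add: power_mult_distrib power_divide)
      also have "\<dots> \<le> c * real (saw_count E (fst p) m) * Y x0 ^ m"
        using c1(2)[of m] Lc(1) Y_pos[OF x0(1)] by (intro mult_right_mono mult_left_mono) auto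
      also have "\<dots> \<le> (\<Sum>K\<in>?A. s K * x0 ^ K)" unfolding s_def by (rule Lc(2)) (simp add: m_def)
      finally have S: "c * c1 * l ^ m \<le> (\<Sum>K\<in>?A. s K * x0 ^ K)" .
      \<comment> \<open>A sum with a positive lower bound has a nonempty window.\<close>
      have "c * c1 * l ^ m > 0" using Lc(1) c1(1) l by simp
      hence A: "finite ?A" "?A \<noteq> {}" using S by (auto intro: ccontr)
      obtain K where K: "K \<in> ?A" "c * c1 * l ^ m \<le> real (card ?A) * (s K * x0 ^ K)"
        by (rule ex_ge_average[OF A S])
      have sK: "s K * x0 ^ K \<ge> 0" using x0(1) by (simp add: s_def)
      have "card ?A \<le> (L + 1) * (m + 1)" by simp
      hence "real (card ?A) * (s K * x0 ^ K) \<le> real ((L + 1) * (m + 1)) * (s K * x0 ^ K)"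
        using sK by (intro mult_right_mono) (simp_all only: of_nat_le_iff)
      hence K2: "c * c1 * l ^ m \<le> (real L + 1) * (real m + 1) * (s K * x0 ^ K)"
        using K(2) by (simp add: algebra_simps)
      have "c * c1 * b0 * l ^ (2 * K) \<le> c * c1 * b0 * l ^ (2 * m)"
        using l K(1) Lc(1) c1(1) b0(1) by (intro mult_left_mono power_decreasing) auto
      also have "\<dots> = c * c1 * l ^ m * (b0 * l ^ m)" by (simp add: mult_2 power_add)
      also have "\<dots> \<le> (real L + 1) * (real m + 1) * (s K * x0 ^ K) * (b0 * l ^ m)"
        using K2 b0(1) l by (intro mult_right_mono) auto
      also have "\<dots> = (real L + 1) * (s K * x0 ^ K) * (b0 * (real m + 1) * l ^ m)"
        by (simp add: mult_ac)
      also have "\<dots> \<le> (real L + 1) * (s K * x0 ^ K) * 1"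
        using b0(2)[of m] sK by (intro mult_left_mono) auto
      finally have "c2 * l ^ (2 * K) \<le> s K * x0 ^ K"
        by (simp add: c2_def field_simps)
      hence "c2 * ((1 / x0) ^ K * l ^ (2 * K)) \<le> s K"
        using x0(1) by (simp add: power_divide field_simps)
      moreover have "n \<le> K" "K \<le> (2 * L) * (n + 1)"
      proof -
        show "n \<le> K" using K(1) by (simp add: m_def)
        have "K \<le> L * (m + 1)" using K(1) by simp
        also have "\<dots> \<le> L * (2 * (n + 1))" by (intro mult_left_mono) (auto simp: m_def)
        finally show "K \<le> (2 * L) * (n + 1)" by (simp only: mult_ac)
      qed
      ultimately show ?thesis by blast
    qed
    with \<open>c2 > 0\<close> show ?thesis by blast
  qed
  have "(\<lambda>n. root n (s n)) \<longlonglongrightarrow> 1 / x0"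
  proof (rule root_tendsto_of_geometric_bounds)
    show "1 / x0 > 0" using x0(1) by simp
    show "\<exists>C>0. \<forall>n. s n \<le> C * \<rho> ^ n" if "1 / x0 < \<rho>" for \<rho>
      unfolding s_def using unif[OF that] p by blast
    show "\<exists>c>0. \<forall>n. c * \<rho> ^ n \<le> s n" if "0 < \<rho>" "\<rho> < 1 / x0" for \<rho>
      using geometric_lower_bound_of_sparse[OF _ sub sparse that] x0(1) by simp
  qed
  thus ?thesis by (simp add: s_def)
qed

end

section \<open>Gadget series\<close>

text \<open>Formulated for an injective map into another graph, so as to cover both the injections
  into the sum type and the automorphisms of a gadget.\<close>

lemma gadget_paths_image:
  assumes inj: "inj_on f V" and hom: "\<And>x y. x \<in> V \<Longrightarrow> y \<in> V \<Longrightarrow> E x y \<longleftrightarrow> E' (f x) (f y)"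
    and p: "p \<in> V" and q: "q \<in> V"
  shows "gadget_paths (f ` V) E' (f p) (f q) = map f ` gadget_paths V E p q"
proof (intro equalityI subsetI)
  fix ys assume "ys \<in> gadget_paths (f ` V) E' (f p) (f q)"
  note ys = gadget_pathsD[OF this]
  have "ys \<in> lists (f ` V)" using ys(4) by (simp only: lists_eq_set mem_Collect_eq)
  hence "ys \<in> map f ` lists V" by (simp only: lists_image)
  then obtain xs where xs: "ys = map f xs" "set xs \<subseteq> V" by (auto simp: lists_eq_set)
  have ne: "xs \<noteq> []" "hd xs \<in> V" "last xs \<in> V" using ys(1) xs by auto
  have "hd xs = p" "last xs = q"
    using ys(2,3) ne p q inj by (auto simp: xs(1) hd_map last_map dest: inj_onD)
  moreover have "successively E xs"
    using ys(6) unfolding xs(1) successively_map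
    by (rule successively_mono) (use xs(2) hom in blast)
  ultimately have "xs \<in> gadget_paths V E p q"
    using ne xs ys(5) by (simp add: gadget_paths_def is_walk_successively distinct_map)
  thus "ys \<in> map f ` gadget_paths V E p q" using xs(1) by blast
next
  fix ys assume "ys \<in> map f ` gadget_paths V E p q"
  then obtain xs where eq: "ys = map f xs" and "xs \<in> gadget_paths V E p q" by blast
  note xs = gadget_pathsD[OF this(2)]
  have "successively (\<lambda>x y. E' (f x) (f y)) xs"
    by (rule successively_mono[OF xs(6)]) (use xs(4) hom in blast)
  thus "ys \<in> gadget_paths (f ` V) E' (f p) (f q)"
    using xs inj_on_subset[OF inj xs(4)]
    by (auto simp: eq gadget_paths_def is_walk_successively successively_map distinct_map hd_map last_map)
qed

lemma gadget_series_image: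
  assumes inj: "inj_on f V" and hom: "\<And>x y. x \<in> V \<Longrightarrow> y \<in> V \<Longrightarrow> E x y \<longleftrightarrow> E' (f x) (f y)"
    and "p \<in> V" "q \<in> V"
  shows "gadget_series (f ` V) E' (f p) (f q) x = gadget_series V E p q x"
proof -
  have "inj_on (map f) (gadget_paths V E p q)"
  proof (rule inj_onI)
    fix xs ys assume *: "xs \<in> gadget_paths V E p q" "ys \<in> gadget_paths V E p q" "map f xs = map f ys"
    have "set xs \<union> set ys \<subseteq> V" using *(1,2)[THEN gadget_pathsD(4)] by blast
    from map_inj_on[OF *(3) inj_on_subset[OF inj this]] show "xs = ys" .
  qed
  thus ?thesis unfolding gadget_series_def 
    by (subst gadget_paths_image[of f V E E' p q, OF assms]) (simp_all add: sum.reindex)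
qed

lemma gadget_series_commute:
  assumes "\<And>x y. E x y \<Longrightarrow> E y x"
  shows "gadget_series V E p q x = gadget_series V E q p x"
proof -
  have E: "(\<lambda>x y. E y x) = E" using assms by blast
  have rev: "rev xs \<in> gadget_paths V E q p" if "xs \<in> gadget_paths V E p q" for xs p q
  proof -
    have "successively E (rev xs)" using gadget_pathsD(6)[OF that] by (simp only: successively_rev E)
    thus ?thesis
      using that unfolding gadget_paths_def is_walk_successively by (simp add: hd_rev last_rev)
  qed
  have "rev ` gadget_paths V E p q = gadget_paths V E q p"
  proof (intro equalityI subsetI)
    fix xs assume "xs \<in> gadget_paths V E q p"
    thus "xs \<in> rev ` gadget_paths V E p q" using rev[of xs q p] by (metis image_eqI rev_rev_ident)
  qed (use rev in blast)
  moreover have "(\<Sum>xs\<in>rev ` gadget_paths V E p q. x ^ length xs) = gadget_series V E p q x"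
    by (subst sum.reindex) (auto simp: gadget_series_def inj_on_def)
  ultimately show ?thesis by (simp add: gadget_series_def)
qed

text \<open>Transitivity concerns single ports, not pairs. An automorphism taking the third port to
  \<open>w3\<close> takes \<open>p\<close> and \<open>q\<close> to \<open>w1\<close> and
  \<open>w2\<close> in some order, and reversing paths settles the order.\<close>

lemma gadget_series_ports:
  assumes lt: "local_transformation V E w1 w2 w3"
    and pq: "p \<in> {w1, w2, w3}" "q \<in> {w1, w2, w3}" "p \<noteq> q"
  shows "gadget_series V E p q x = gadget_series V E w1 w2 x"
proof -
  have w: "w1 \<noteq> w2" "w1 \<noteq> w3" "w2 \<noteq> w3" "{w1, w2, w3} \<subseteq> V" and sym: "\<And>x y. E x y \<Longrightarrow> E y x"
    and ps: "port_symmetric V E {w1, w2, w3}"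
    using lt by (auto simp: local_transformation_def simple_graph_def)
  obtain r where r: "r \<in> {w1, w2, w3}" "r \<noteq> p" "r \<noteq> q" using pq w by auto
  then obtain \<alpha> where \<alpha>: "graph_aut V E \<alpha>" "\<alpha> ` {w1, w2, w3} = {w1, w2, w3}" "\<alpha> r = w3"
    using ps unfolding port_symmetric_def by (metis insertCI)
  have bij: "inj_on \<alpha> V" "\<alpha> ` V = V" using \<alpha>(1) by (auto simp: graph_aut_def bij_betw_def)
  have V: "p \<in> V" "q \<in> V" "r \<in> V" using pq r w by auto
  have "\<alpha> p \<in> {w1, w2, w3}" "\<alpha> q \<in> {w1, w2, w3}" using \<alpha>(2) pq by blast+
  moreover have "\<alpha> p \<noteq> w3" "\<alpha> q \<noteq> w3" "\<alpha> p \<noteq> \<alpha> q"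
    using bij(1) V r pq \<alpha>(3) by (metis inj_onD)+
  ultimately have "(\<alpha> p = w1 \<and> \<alpha> q = w2) \<or> (\<alpha> p = w2 \<and> \<alpha> q = w1)" by auto
  moreover have "gadget_series V E p q x = gadget_series (\<alpha> ` V) E (\<alpha> p) (\<alpha> q) x"
    using \<alpha>(1) V by (intro gadget_series_image[symmetric] bij) (auto simp: graph_aut_def)
  ultimately show ?thesis using bij(2) gadget_series_commute[of E V w2 w1 x, OF sym] by auto
qed

lemma gadget_paths_nonempty:
  assumes "simple_graph V E" "connected_graph V E" "p \<in> V" "q \<in> V"
  shows "gadget_paths V E p q \<noteq> {}"
proof -
  have "E\<^sup>*\<^sup>* p q" using assms by (simp add: connected_graph_def)
  then obtain xs where xs: "xs \<noteq> []" "hd xs = p" "last xs = q" "distinct xs" "successively E xs"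
    by (rule rtranclp_path)
  moreover have "set xs \<subseteq> V"
    using walk_vertices[OF _ xs(5,1)] assms xs(2) by (auto simp: simple_graph_def)
  ultimately show ?thesis by (auto simp: gadget_paths_def is_walk_successively)
qed

lemma finite_gadget_paths: "finite V \<Longrightarrow> finite (gadget_paths V E p q)"
  by (rule finite_subset[OF _ finite_subset_distinct[of V]]) (auto simp: gadget_paths_def)

lemma
  assumes fin: "finite V" and ne: "gadget_paths V E p q \<noteq> {}"
  shows gadget_series_0: "gadget_series V E p q 0 = 0"
    and gadget_series_ge_1: "gadget_series V E p q 1 \<ge> 1"
    and gadget_series_pos: "x > 0 \<Longrightarrow> gadget_series V E p q x > 0"
    and gadget_series_strict_mono: "0 \<le> x \<Longrightarrow> x < x' \<Longrightarrow> gadget_series V E p q x < gadget_series V E p q x'"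
    and continuous_gadget_series: "continuous_on A (gadget_series V E p q)"
proof -
  note fin' = finite_gadget_paths[OF fin, of E p q]
  have len: "length xs > 0" if "xs \<in> gadget_paths V E p q" for xs using gadget_pathsD(1)[OF that] by simp
  show "gadget_series V E p q 0 = 0"
    unfolding gadget_series_def using gadget_pathsD(1) by (fastforce intro!: sum.neutral)
  show "gadget_series V E p q 1 \<ge> 1"
    unfolding gadget_series_def using fin' ne by (simp add: Suc_le_eq card_gt_0_iff)
  show "gadget_series V E p q x > 0" if "x > 0"
    unfolding gadget_series_def using fin' ne that by (intro sum_pos) auto
  show "gadget_series V E p q x < gadget_series V E p q x'" if "0 \<le> x" "x < x'"
    unfolding gadget_series_def using fin' ne that len
    by (intro sum_strict_mono power_strict_mono) auto
  show "continuous_on A (gadget_series V E p q)"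
    unfolding gadget_series_def by (intro continuous_intros)
qed

lemma prod_list_alternating:
  fixes g1 g2 y :: real
  assumes "successively (\<lambda>u v. col u \<noteq> col v) ws" "y ^ 2 = g1 * g2"
  shows "(\<Prod>w\<leftarrow>ws. if col w then g1 else g2) =
    (if even (length ws) then y ^ length ws
     else y ^ (length ws - 1) * (if col (hd ws) then g1 else g2))"
  using assms(1)
proof (induction ws rule: induct_list012)
  case (3 u v ws)
  \<comment> \<open>Neighbours have different colours, so a consecutive pair contributes
    \<open>g1 * g2\<close> whichever comes first.\<close>
  have "(if col u then g1 else g2) * (if col v then g1 else g2) = y ^ 2"
    using 3(3) assms(2) by auto
  hence "(\<Prod>w\<leftarrow>u # v # ws. if col w then g1 else g2) = y ^ 2 * (\<Prod>w\<leftarrow>ws. if col w then g1 else g2)"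
    by (simp add: mult.assoc[symmetric])
  also have "(\<Prod>w\<leftarrow>ws. if col w then g1 else g2) = (if even (length ws) then y ^ length ws
     else y ^ (length ws - 1) * (if col (hd ws) then g1 else g2))"
    using 3(1,3) by (cases ws) auto
  also have "y ^ 2 * \<dots> = (if even (length (u # v # ws)) then y ^ length (u # v # ws)
     else y ^ (length (u # v # ws) - 1) * (if col (hd (u # v # ws)) then g1 else g2))"
  proof (cases "even (length ws)")
    case True
    thus ?thesis by (simp add: power2_eq_square mult_ac)
  next
    case False
    then obtain w ws' where ws: "ws = w # ws'" by (cases ws) auto
    have "col w = col u" using 3(3) by (auto simp: ws)
    thus ?thesis using False by (simp add: ws power2_eq_square mult_ac)
  qed
  finally show ?case .
qed auto

text \<open>A list of even length has the product \<open>y ^ length ws\<close> exactly; an odd one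
  has a single \<open>g1\<close> or \<open>g2\<close> in place of a factor \<open>y\<close>, and the
  quotients \<open>g1 / y\<close> and \<open>g2 / y\<close> give the constants.\<close>

lemma prod_list_alternating_bounds:
  fixes g1 g2 y :: real
  assumes "g1 > 0" "g2 > 0" "y > 0" "y ^ 2 = g1 * g2"
  obtains K \<kappa> where "K \<ge> 0" "\<kappa> > 0" "\<And>ws. successively (\<lambda>u v. col u \<noteq> col v) ws \<Longrightarrow>
    \<kappa> * y ^ length ws \<le> (\<Prod>w\<leftarrow>ws. if col w then g1 else g2) \<and>
    (\<Prod>w\<leftarrow>ws. if col w then g1 else g2) \<le> K * y ^ length ws"
proof -
  define K where "K = Max {1, g1 / y, g2 / y}"
  define \<kappa> where "\<kappa> = Min {1, g1 / y, g2 / y}"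
  have K: "1 \<le> K" "g1 / y \<le> K" "g2 / y \<le> K" and \<kappa>: "\<kappa> \<le> 1" "\<kappa> \<le> g1 / y" "\<kappa> \<le> g2 / y" "\<kappa> > 0"
    using assms by (auto simp: K_def \<kappa>_def)
  have "\<kappa> * y ^ length ws \<le> (\<Prod>w\<leftarrow>ws. if col w then g1 else g2) \<and>
    (\<Prod>w\<leftarrow>ws. if col w then g1 else g2) \<le> K * y ^ length ws"
    if "successively (\<lambda>u v. col u \<noteq> col v) ws" for ws :: "'a list"
  proof (cases "even (length ws)")
    case True
    thus ?thesis using prod_list_alternating[OF that assms(4)] K \<kappa> assms(3) by simp
  next
    case False
    define h where "h = (if col (hd ws) then g1 else g2)"
    have h: "\<kappa> * y \<le> h" "h \<le> K * y" using K \<kappa> assms(3) by (auto simp: h_def field_simps)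
    obtain n where n: "length ws = Suc n" using False by (cases "length ws") auto
    have "(\<Prod>w\<leftarrow>ws. if col w then g1 else g2) = y ^ n * h"
      using prod_list_alternating[OF that assms(4)] False n by (simp add: h_def)
    moreover have "y ^ n * (\<kappa> * y) \<le> y ^ n * h" "y ^ n * h \<le> y ^ n * (K * y)"
      using h assms(3) by (auto intro!: mult_left_mono)
    ultimately show ?thesis by (simp add: n mult_ac)
  qed
  thus ?thesis using that[of K \<kappa>] K \<kappa> by auto
qed

theorem theorem3p5:
  fixes V :: "'v set" and E :: "'v \<Rightarrow> 'v \<Rightarrow> bool" and col :: "'v \<Rightarrow> bool"
    and V1 :: "'a set" and E1 :: "'a \<Rightarrow> 'a \<Rightarrow> bool" and w1 w2 w3 :: 'a
    and V2 :: "'b set" and E2 :: "'b \<Rightarrow> 'b \<Rightarrow> bool" and z1 z2 z3 :: 'b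
    and port1 :: "'v \<Rightarrow> 'v \<Rightarrow> 'a" and port2 :: "'v \<Rightarrow> 'v \<Rightarrow> 'b"
  assumes "simple_graph V E" and "infinite V" and "connected_graph V E"
    and "proper_bicolouring E col"
    and "coloured_quasi_transitive V E col"
    and "\<forall>v\<in>V. degree E v = 3"
    and "local_transformation V1 E1 w1 w2 w3"
    and "local_transformation V2 E2 z1 z2 z3"
    and "valid_ports V E col {w1, w2, w3} {z1, z2, z3} port1 port2"
    and "connected_graph (tr_vertices V col V1 V2) (tr_edges V E col V1 E1 V2 E2 port1 port2)"
    and "v \<in> V" and "vt \<in> tr_vertices V col V1 V2"
  shows "inverse ((connective_constant E v)\<^sup>2) =
     gadget_series V1 E1 w1 w2 (inverse (connective_constant (tr_edges V E col V1 E1 V2 E2 port1 port2) vt)) *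
     gadget_series V2 E2 z1 z2 (inverse (connective_constant (tr_edges V E col V1 E1 V2 E2 port1 port2) vt))"
proof -
  have deg: "card {u. E v u} = 3" if "v \<in> V" for v using assms(6) that by (simp add: degree_def)
  interpret G: locally_finite_graph V E
  proof
    show "finite {u. E v u}" if "v \<in> V" for v using deg[OF that] by (intro card_ge_0_finite) simp
  qed fact
  have L1: "simple_graph V1 E1" "finite V1" "connected_graph V1 E1" "{w1, w2, w3} \<subseteq> V1"
    and L2: "simple_graph V2 E2" "finite V2" "connected_graph V2 E2" "{z1, z2, z3} \<subseteq> V2"
    using assms(7,8) by (auto simp: local_transformation_def)
  have port1: "bij_betw (port1 v) {u. E v u} {w1, w2, w3}" if "v \<in> V" "col v" for v
    using assms(9) that by (simp add: valid_ports_def)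
  have port2: "bij_betw (port2 v) {u. E v u} {z1, z2, z3}" if "v \<in> V" "\<not> col v" for v
    using assms(9) that by (simp add: valid_ports_def)
  define GV where "GV v = (if col v then Inl ` V1 else Inr ` V2)" for v
  let ?GE = "sum_edge E1 E2" and ?port = "tr_port col port1 port2"
  have ser1: "gadget_series (Inl ` V1) ?GE (Inl p) (Inl q) x = gadget_series V1 E1 p q x"
    and path1: "gadget_paths (Inl ` V1) ?GE (Inl p) (Inl q) \<noteq> {}"
    if "p \<in> V1" "q \<in> V1" for p q x
    using gadget_series_image[of Inl V1 E1 ?GE p q] gadget_paths_image[of Inl V1 E1 ?GE p q]
      gadget_paths_nonempty[OF L1(1,3) that] that by auto
  have ser2: "gadget_series (Inr ` V2) ?GE (Inr p) (Inr q) x = gadget_series V2 E2 p q x"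
    and path2: "gadget_paths (Inr ` V2) ?GE (Inr p) (Inr q) \<noteq> {}"
    if "p \<in> V2" "q \<in> V2" for p q x
    using gadget_series_image[of Inr V2 E2 ?GE p q] gadget_paths_image[of Inr V2 E2 ?GE p q]
      gadget_paths_nonempty[OF L2(1,3) that] that by auto
  interpret R: gadget_replacement V E GV ?GE ?port
  proof
    show "card {u. E v u} \<le> 3" if "v \<in> V" for v using deg[OF that] by simp
    show "finite (GV v)" for v using L1 L2 by (simp add: GV_def)
    have "GV ` V \<subseteq> {Inl ` V1, Inr ` V2}" by (auto simp: GV_def)
    thus "finite (GV ` V)" by (rule finite_subset) simp
    show "?GE b a" if "?GE a b" for a b
      using that L1(1) L2(1) by (cases a; cases b) (auto simp: simple_graph_def)
    show "\<not> ?GE a a" for a using L1(1) L2(1) by (cases a) (auto simp: simple_graph_def)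
    show "gadget_paths (GV v) ?GE a b \<noteq> {}" if "a \<in> GV v" "b \<in> GV v" for v a b
      using that path1 path2 by (auto simp: GV_def split: if_splits)
    show "?port v u \<in> GV v" if "E v u" for v u
      using that port1[of v] port2[of v] G.edge_in(1)[OF that] L1(4) L2(4)
      by (auto simp: GV_def tr_port_def bij_betw_def)
  qed
  have VT: "tr_vertices V col V1 V2 = Sigma V GV"
    by (auto simp: tr_vertices_def GV_def split: if_splits)
  have ET: "tr_edges V E col V1 E1 V2 E2 port1 port2 = R.ET"
    by (intro ext) (simp add: tr_edges_def R.ET_def VT)
  define g1 where "g1 = gadget_series V1 E1 w1 w2"
  define g2 where "g2 = gadget_series V2 E2 z1 z2"
  define g where "g v = (if col v then g1 else g2)" for v
  \<comment> \<open>The geometric mean of the two series, since crossings of black and white gadgets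
    alternate.\<close>
  define Y where "Y x = sqrt (g1 x * g2 x)" for x
  have ne1: "gadget_paths V1 E1 w1 w2 \<noteq> {}" and ne2: "gadget_paths V2 E2 z1 z2 \<noteq> {}"
    using gadget_paths_nonempty[OF L1(1,3)] L1(4) gadget_paths_nonempty[OF L2(1,3)] L2(4) by auto
  note g1 = gadget_series_0[OF L1(2) ne1, folded g1_def] gadget_series_ge_1[OF L1(2) ne1, folded g1_def]
    gadget_series_pos[OF L1(2) ne1, folded g1_def] gadget_series_strict_mono[OF L1(2) ne1, folded g1_def]
    continuous_gadget_series[OF L1(2) ne1, folded g1_def]
  note g2 = gadget_series_0[OF L2(2) ne2, folded g2_def] gadget_series_ge_1[OF L2(2) ne2, folded g2_def]
    gadget_series_pos[OF L2(2) ne2, folded g2_def] gadget_series_strict_mono[OF L2(2) ne2, folded g2_def]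
    continuous_gadget_series[OF L2(2) ne2, folded g2_def]
  have series: "(\<Sum>r\<in>gadget_paths (GV v) ?GE (?port v u) (?port v u'). x ^ length r) = g v x"
    if "E v u" "E v u'" "u \<noteq> u'" for v u u' x
  proof -
    have v: "v \<in> V" using that G.edge_in by blast
    have "gadget_series (GV v) ?GE (?port v u) (?port v u') x = g v x"
    proof (cases "col v")
      case True
      have *: "port1 v u \<in> {w1, w2, w3}" "port1 v u' \<in> {w1, w2, w3}" "port1 v u \<noteq> port1 v u'"
        using port1[OF v True] that by (auto simp: bij_betw_def dest: inj_onD)
      hence "gadget_series V1 E1 (port1 v u) (port1 v u') x = g1 x"
        unfolding g1_def by (rule gadget_series_ports[OF assms(7)])
      thus ?thesis using True ser1[of "port1 v u" "port1 v u'" x] * L1(4)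
        by (auto simp: GV_def tr_port_def g_def)
    next
      case False
      have *: "port2 v u \<in> {z1, z2, z3}" "port2 v u' \<in> {z1, z2, z3}" "port2 v u \<noteq> port2 v u'"
        using port2[OF v False] that by (auto simp: bij_betw_def dest: inj_onD)
      hence "gadget_series V2 E2 (port2 v u) (port2 v u') x = g2 x"
        unfolding g2_def by (rule gadget_series_ports[OF assms(8)])
      thus ?thesis using False ser2[of "port2 v u" "port2 v u'" x] * L2(4)
        by (auto simp: GV_def tr_port_def g_def)
    qed
    thus ?thesis by (simp add: gadget_series_def)
  qed
  obtain W where W: "finite W" "W \<subseteq> V" "\<And>v. v \<in> V \<Longrightarrow> \<exists>\<alpha>. graph_aut V E \<alpha> \<and> \<alpha> v \<in> W"
    using assms(5) unfolding coloured_quasi_transitive_def coloured_aut_def by metis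
  obtain \<mu> where \<mu>: "\<mu> \<ge> 1"
    and upper: "\<And>\<rho>. \<mu> < \<rho> \<Longrightarrow> \<exists>C>0. \<forall>v\<in>V. \<forall>n. real (saw_count E v n) \<le> C * \<rho> ^ n"
    and lower: "\<And>v \<rho>. v \<in> V \<Longrightarrow> 0 < \<rho> \<Longrightarrow> \<rho> < \<mu> \<Longrightarrow> \<exists>c>0. \<forall>n. c * \<rho> ^ n \<le> real (saw_count E v n)"
    using G.quasi_transitive_saw_growth[OF assms(2,3) W] by metis
  have "(\<lambda>n. root n (real (saw_count E v n))) \<longlonglongrightarrow> \<mu>"
  proof (rule root_tendsto_of_geometric_bounds)
    show "\<exists>C>0. \<forall>n. real (saw_count E v n) \<le> C * \<rho> ^ n" if "\<mu> < \<rho>" for \<rho>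
      using upper[OF that] assms(11) by blast
  qed (use \<mu> lower[OF assms(11)] in auto)
  hence cc: "connective_constant E v = \<mu>" unfolding connective_constant_def by (rule limI)
  \<comment> \<open>Intermediate values on the unit interval: the product is 0 at 0 and at least 1
    at 1, each series counting paths there, while \<open>\<mu> \<ge> 1\<close> puts the target value
    below 1 or at it.\<close>
  obtain x0 where x0: "0 \<le> x0" "g1 x0 * g2 x0 = inverse (\<mu>\<^sup>2)"
  proof -
    have "1 * 1 \<le> g1 1 * g2 1" using g1(2) g2(2) by (intro mult_mono) auto
    moreover have "inverse (\<mu>\<^sup>2) \<le> 1" using \<mu> by (simp add: field_simps)
    moreover have "continuous_on {0..1} (\<lambda>x. g1 x * g2 x)" by (intro continuous_on_mult g1 g2)
    ultimately have "\<exists>x\<ge>0. x \<le> 1 \<and> g1 x * g2 x = inverse (\<mu>\<^sup>2)"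
      using g1(1) by (intro IVT') auto
    thus ?thesis using that by blast
  qed
  have "x0 \<noteq> 0"
  proof
    assume "x0 = 0"
    thus False using x0(2) g1(1) \<mu> by simp
  qed
  hence x0_pos: "x0 > 0" using x0(1) by simp
  have Y_pos: "Y x > 0" if "x > 0" for x using g1(3)[OF that] g2(3)[OF that] by (simp add: Y_def)
  have "(\<lambda>n. root n (real (saw_count R.ET vt n))) \<longlonglongrightarrow> 1 / x0"
  proof (rule R.root_lifted_saw_count_tendsto[where \<mu> = \<mu> and g = g and Y = Y])
    show "g v x > 0" if "x > 0" for v x using g1(3)[OF that] g2(3)[OF that] by (simp add: g_def)
    show "Y x < Y x0" if "0 < x" "x < x0" for x
      unfolding Y_def using that g1(3)[of x] g2(3)[of x] g1(4)[of x x0] g2(4)[of x x0]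
      by (intro real_sqrt_less_mono mult_strict_mono) auto
    show "Y x0 = 1 / \<mu>" using x0(2) \<mu> by (simp add: Y_def real_sqrt_divide inverse_eq_divide)
    show "\<exists>K \<kappa>. K \<ge> 0 \<and> \<kappa> > 0 \<and> (\<forall>ws. successively E ws \<longrightarrow> set ws \<subseteq> V \<longrightarrow>
      \<kappa> * Y x ^ length ws \<le> (\<Prod>w\<leftarrow>ws. g w x) \<and> (\<Prod>w\<leftarrow>ws. g w x) \<le> K * Y x ^ length ws)" if x: "x > 0" for x
    proof -
      have "Y x ^ 2 = g1 x * g2 x" using g1(3)[OF x] g2(3)[OF x] by (simp add: Y_def)
      then obtain K \<kappa> where K\<kappa>: "K \<ge> 0" "\<kappa> > 0" "\<And>ws. successively (\<lambda>u v. col u \<noteq> col v) ws \<Longrightarrow>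
          \<kappa> * Y x ^ length ws \<le> (\<Prod>w\<leftarrow>ws. if col w then g1 x else g2 x) \<and>
          (\<Prod>w\<leftarrow>ws. if col w then g1 x else g2 x) \<le> K * Y x ^ length ws"
        using prod_list_alternating_bounds[OF g1(3)[OF x] g2(3)[OF x] Y_pos[OF x]] by metis
      have "(\<Prod>w\<leftarrow>ws. g w x) = (\<Prod>w\<leftarrow>ws. if col w then g1 x else g2 x)" for ws
        by (simp add: g_def if_distrib[of "\<lambda>f. f x"] cong: if_cong)
      moreover have "successively (\<lambda>u v. col u \<noteq> col v) ws" if "successively E ws" for ws
        by (rule successively_mono[OF that]) (use assms(4) in \<open>auto simp: proper_bicolouring_def\<close>)
      ultimately show ?thesis using K\<kappa> by metis
    qed
    show "vt \<in> Sigma V GV" using assms(12) by (simp add: VT)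
  qed (fact \<mu> | fact upper | fact lower | fact series | fact Y_pos | fact x0_pos)+
  hence cct: "connective_constant (tr_edges V E col V1 E1 V2 E2 port1 port2) vt = 1 / x0"
    unfolding connective_constant_def ET by (rule limI)
  show ?thesis unfolding cc cct using x0(2) by (simp add: g1_def g2_def inverse_eq_divide)
qed

end
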